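(* For every finite partially ordered set $(\mathcal{A},\leq)$, one has \[(\mathcal{A},\leq)\sim_{\mathrm{M}}\mathcal{Z}_{(\mathcal{A},\leq)},\] where $\mathcal{Z}_{(\mathcal{A},\leq)}=(Z,\mathcal{L})$ is the connectivity space with set of points $Z=\mathcal{A}$ and connectivity structure $\mathcal{L}=[\{\downarrow z : z\in Z\}]$, with $\downarrow z=\{x\in Z : x\leq z\}$. That is, the category of presheaves of sets on $(\mathcal{A},\leq)$ is equivalent to the topos $Sh(Z,\mathcal{L})$.
   Context: A connectivity structure on a set $X$ is a set $\mathcal{K}\subset\mathcal{P}X$ of subsets (called connected) with $\emptyset\in\mathcal{K}$ such that the union of any family of members of $\mathcal{K}$ with non-empty intersection belongs to $\mathcal{K}$ (singletons need not be connected). The pair $(X,\mathcal{K})$ is a connectivity space. For $\mathcal{C}\subset\mathcal{P}X$, $[\mathcal{C}]$ denotes the connectivity structure on $X$ generated by $\mathcal{C}$, i.e. the smallest (for inclusion) connectivity structure on $X$ containing $\mathcal{C}$. The poset $(\mathcal{K},\subset)$ is regarded as a small category. A sieve on $A\in\mathcal{K}$ is a pair $\sigma=(\dot\sigma,A)$ with $\dot\sigma\subset\mathcal{K}\cap\mathcal{P}A$ and $\mathcal{K}\cap\mathcal{P}B\subset\dot\sigma$ for all $B\in\dot\sigma$ (possibly $\dot\sigma=\emptyset$). The site of $(X,\mathcal{K})$ is $(\mathcal{K},J)$, where the covering sieves $J(A)$ of $A\in\mathcal{K}$ are the sieves $\sigma$ on $A$ with $[\dot\sigma]=\mathcal{K}\cap\mathcal{P}A$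 (this is a Grothendieck topology), and $Sh(X,\mathcal{K})$ is the topos of sheaves of sets on $(\mathcal{K},J)$. The topos of a poset $(P,\leq)$ is the category of functors $(P,\leq)^{op}\to\mathbf{Set}$ (presheaves). $\sim_{\mathrm{M}}$ (Morita equivalence) means that the associated topoi are equivalent categories. *)

theory Defs
  imports "HOL-Library.FuncSet" "HOL-Library.Equipollence" "HOL.Order_Relation"
begin

section \<open>Categories, functors, natural transformations\<close>

text \<open>
  Hom-sets are indexed by source and target and need not be disjoint, so composition carries
  the three objects involved: \<open>Comp C x y z g f\<close> is the composite of \<open>f : x \<rightarrow> y\<close> and \<open>g : y \<rightarrow> z\<close>.
\<close>

record ('o, 'a) cat =
  Ob :: "'o set"
  Hom :: "'o \<Rightarrow> 'o \<Rightarrow> 'a set"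
  Idn :: "'o \<Rightarrow> 'a"
  Comp :: "'o \<Rightarrow> 'o \<Rightarrow> 'o \<Rightarrow> 'a \<Rightarrow> 'a \<Rightarrow> 'a"

definition category :: "('o, 'a) cat \<Rightarrow> bool" where
  "category C \<longleftrightarrow>
     (\<forall>x\<in>Ob C. Idn C x \<in> Hom C x x) \<and>
     (\<forall>x\<in>Ob C. \<forall>y\<in>Ob C. \<forall>z\<in>Ob C. \<forall>f\<in>Hom C x y. \<forall>g\<in>Hom C y z.
        Comp C x y z g f \<in> Hom C x z) \<and>
     (\<forall>x\<in>Ob C. \<forall>y\<in>Ob C. \<forall>f\<in>Hom C x y.
        Comp C x x y f (Idn C x) = f \<and> Comp C x y y (Idn C y) f = f) \<and>
     (\<forall>w\<in>Ob C. \<forall>x\<in>Ob C. \<forall>y\<in>Ob C. \<forall>z\<in>Ob C.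
        \<forall>f\<in>Hom C w x. \<forall>g\<in>Hom C x y. \<forall>h\<in>Hom C y z.
        Comp C w y z h (Comp C w x y g f) = Comp C w x z (Comp C x y z h g) f)"

definition op_cat :: "('o, 'a) cat \<Rightarrow> ('o, 'a) cat" where
  "op_cat C = \<lparr>Ob = Ob C, Hom = (\<lambda>x y. Hom C y x), Idn = Idn C,
               Comp = (\<lambda>x y z g f. Comp C z y x f g)\<rparr>"

definition full_subcat :: "('o, 'a) cat \<Rightarrow> ('o \<Rightarrow> bool) \<Rightarrow> ('o, 'a) cat" where
  "full_subcat C P = C\<lparr>Ob := {x \<in> Ob C. P x}\<rparr>"

definition is_iso :: "('o, 'a) cat \<Rightarrow> 'o \<Rightarrow> 'o \<Rightarrow> 'a \<Rightarrow> bool" where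
  "is_iso C x y f \<longleftrightarrow> f \<in> Hom C x y \<and>
     (\<exists>g\<in>Hom C y x. Comp C x y x g f = Idn C x \<and> Comp C y x y f g = Idn C y)"

record ('o, 'a, 'p, 'b) cfun =
  FOb :: "'o \<Rightarrow> 'p"
  FAr :: "'o \<Rightarrow> 'o \<Rightarrow> 'a \<Rightarrow> 'b"

text \<open>
  The last two conjuncts (value \<open>undefined\<close> off the source category) only serve to make equality
  of functors agree with HOL equality. The same holds for \<open>extensional\<close> in \<open>nat_trans\<close>.
\<close>

definition is_functor :: "('o, 'a) cat \<Rightarrow> ('p, 'b) cat \<Rightarrow> ('o, 'a, 'p, 'b) cfun \<Rightarrow> bool" where
  "is_functor C D F \<longleftrightarrow>
     (\<forall>x\<in>Ob C. FOb F x \<in> Ob D) \<and>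
     (\<forall>x\<in>Ob C. \<forall>y\<in>Ob C. \<forall>f\<in>Hom C x y. FAr F x y f \<in> Hom D (FOb F x) (FOb F y)) \<and>
     (\<forall>x\<in>Ob C. FAr F x x (Idn C x) = Idn D (FOb F x)) \<and>
     (\<forall>x\<in>Ob C. \<forall>y\<in>Ob C. \<forall>z\<in>Ob C. \<forall>f\<in>Hom C x y. \<forall>g\<in>Hom C y z.
        FAr F x z (Comp C x y z g f) =
          Comp D (FOb F x) (FOb F y) (FOb F z) (FAr F y z g) (FAr F x y f)) \<and>
     (\<forall>x. x \<notin> Ob C \<longrightarrow> FOb F x = undefined) \<and>
     (\<forall>x y f. \<not> (x \<in> Ob C \<and> y \<in> Ob C \<and> f \<in> Hom C x y) \<longrightarrow> FAr F x y f = undefined)"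

definition id_functor :: "('o, 'a) cat \<Rightarrow> ('o, 'a, 'o, 'a) cfun" where
  "id_functor C =
     \<lparr>FOb = (\<lambda>x. if x \<in> Ob C then x else undefined),
      FAr = (\<lambda>x y f. if x \<in> Ob C \<and> y \<in> Ob C \<and> f \<in> Hom C x y then f else undefined)\<rparr>"

definition comp_functor ::
  "('o, 'a) cat \<Rightarrow> ('p, 'b, 'q, 'c) cfun \<Rightarrow> ('o, 'a, 'p, 'b) cfun \<Rightarrow> ('o, 'a, 'q, 'c) cfun" where
  "comp_functor C G F =
     \<lparr>FOb = (\<lambda>x. if x \<in> Ob C then FOb G (FOb F x) else undefined),
      FAr = (\<lambda>x y f. if x \<in> Ob C \<and> y \<in> Ob C \<and> f \<in> Hom C x y
                     then FAr G (FOb F x) (FOb F y) (FAr F x y f) else undefined)\<rparr>"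

definition nat_trans ::
  "('o, 'a) cat \<Rightarrow> ('p, 'b) cat \<Rightarrow> ('o, 'a, 'p, 'b) cfun \<Rightarrow> ('o, 'a, 'p, 'b) cfun \<Rightarrow> ('o \<Rightarrow> 'b) \<Rightarrow> bool"
where
  "nat_trans C D F G t \<longleftrightarrow>
     t \<in> extensional (Ob C) \<and>
     (\<forall>x\<in>Ob C. t x \<in> Hom D (FOb F x) (FOb G x)) \<and>
     (\<forall>x\<in>Ob C. \<forall>y\<in>Ob C. \<forall>f\<in>Hom C x y.
        Comp D (FOb F x) (FOb F y) (FOb G y) (t y) (FAr F x y f) =
        Comp D (FOb F x) (FOb G x) (FOb G y) (FAr G x y f) (t x))"

definition nat_iso ::
  "('o, 'a) cat \<Rightarrow> ('p, 'b) cat \<Rightarrow> ('o, 'a, 'p, 'b) cfun \<Rightarrow> ('o, 'a, 'p, 'b) cfun \<Rightarrow> ('o \<Rightarrow> 'b) \<Rightarrow> bool"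
where
  "nat_iso C D F G t \<longleftrightarrow>
     nat_trans C D F G t \<and> (\<forall>x\<in>Ob C. is_iso D (FOb F x) (FOb G x) (t x))"

definition functor_cat ::
  "('o, 'a) cat \<Rightarrow> ('p, 'b) cat \<Rightarrow> (('o, 'a, 'p, 'b) cfun, 'o \<Rightarrow> 'b) cat" where
  "functor_cat C D =
     \<lparr>Ob = {F. is_functor C D F},
      Hom = (\<lambda>F G. {t. nat_trans C D F G t}),
      Idn = (\<lambda>F. \<lambda>x\<in>Ob C. Idn D (FOb F x)),
      Comp = (\<lambda>F G H s t. \<lambda>x\<in>Ob C. Comp D (FOb F x) (FOb G x) (FOb H x) (s x) (t x))\<rparr>"

definition equivalent_categories :: "('o, 'a) cat \<Rightarrow> ('p, 'b) cat \<Rightarrow> bool" where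
  "equivalent_categories C D \<longleftrightarrow> category C \<and> category D \<and>
     (\<exists>F G \<eta> \<epsilon>. is_functor C D F \<and> is_functor D C G \<and>
        nat_iso C C (id_functor C) (comp_functor C G F) \<eta> \<and>
        nat_iso D D (comp_functor D F G) (id_functor D) \<epsilon>)"


section \<open>The category of sets\<close>

text \<open>
  HOL has no type of all sets, so the category of sets is taken relative to a family \<open>U\<close> of
  ``small'' sets of elements of some type. Only the closure properties below are required of \<open>U\<close>.
  They hold for the members of any nonempty Grothendieck universe (in particular for the small
  sets over a type of ZFC sets) and for the family of all sets over an infinite type
  (lemma \<open>set_universe_UNIV\<close>).
\<close>

definition set_universe :: "'u set set \<Rightarrow> bool" where
  "set_universe U \<longleftrightarrow>
     (\<exists>A\<in>U. A \<noteq> {}) \<and>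
     (\<forall>A\<in>U. \<forall>B. B \<subseteq> A \<longrightarrow> B \<in> U) \<and>
     (\<forall>A\<in>U. \<forall>B\<in>U. \<exists>C\<in>U. C \<approx> A \<times> B)"

definition set_cat :: "'u set set \<Rightarrow> ('u set, 'u \<Rightarrow> 'u) cat" where
  "set_cat U =
     \<lparr>Ob = U, Hom = (\<lambda>A B. A \<rightarrow>\<^sub>E B), Idn = (\<lambda>A. \<lambda>a\<in>A. a), Comp = (\<lambda>A B C g f. compose A g f)\<rparr>"

lemma set_universe_UNIV:
  assumes "infinite (UNIV :: 'u set)"
  shows "set_universe (UNIV :: 'u set set)"
proof -
  have prod: "\<exists>C::'u set. C \<approx> A \<times> B" for A B :: "'u set"
  proof -
    have "(UNIV :: 'u set) \<times> (UNIV :: 'u set) \<approx> (UNIV :: 'u set)"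
      using card_of_Times_same_infinite[OF assms] card_of_ordIso eqpoll_def by blast
    then obtain h :: "'u \<times> 'u \<Rightarrow> 'u" where h: "bij_betw h (UNIV \<times> UNIV) UNIV"
      unfolding eqpoll_def by blast
    then have "inj_on h (A \<times> B)"
      by (meson bij_betw_imp_inj_on inj_on_subset Sigma_mono subset_UNIV)
    then have "h ` (A \<times> B) \<approx> A \<times> B"
      by (rule inj_on_image_eqpoll_self)
    then show ?thesis by blast
  qed
  show ?thesis
    unfolding set_universe_def using prod by blast
qed


section \<open>Presheaves on a poset\<close>

definition poset_cat :: "'p set \<Rightarrow> 'p rel \<Rightarrow> ('p, unit) cat" where
  "poset_cat P r =
     \<lparr>Ob = P, Hom = (\<lambda>x y. if (x, y) \<in> r then {()} else {}),
      Idn = (\<lambda>x. ()), Comp = (\<lambda>x y z g f. ())\<rparr>"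

type_synonym ('p, 'u) psh = "('p, unit, 'u set, 'u \<Rightarrow> 'u) cfun"

definition psh_cat :: "'u set set \<Rightarrow> 'p set \<Rightarrow> 'p rel \<Rightarrow> (('p, 'u) psh, 'p \<Rightarrow> 'u \<Rightarrow> 'u) cat" where
  "psh_cat U P r = functor_cat (op_cat (poset_cat P r)) (set_cat U)"


section \<open>Connectivity spaces and their topoi\<close>

text \<open>
  For the empty family, \<open>\<Inter>{} = UNIV\<close> makes the condition below amount to \<open>{} \<in> K\<close>, which is
  required anyway.
\<close>

definition connectivity_structure :: "'x set \<Rightarrow> 'x set set \<Rightarrow> bool" where
  "connectivity_structure X K \<longleftrightarrow>
     K \<subseteq> Pow X \<and> {} \<in> K \<and> (\<forall>\<F>. \<F> \<subseteq> K \<longrightarrow> \<Inter>\<F> \<noteq> {} \<longrightarrow> \<Union>\<F> \<in> K)"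

definition generated :: "'x set \<Rightarrow> 'x set set \<Rightarrow> 'x set set" where
  "generated X \<C> = \<Inter>{K. connectivity_structure X K \<and> \<C> \<subseteq> K}"

lemma connectivity_structure_generated:
  assumes "\<C> \<subseteq> Pow X"
  shows "connectivity_structure X (generated X \<C>)"
proof -
  have "connectivity_structure X (Pow X)"
    unfolding connectivity_structure_def by auto
  then have "generated X \<C> \<subseteq> Pow X"
    using assms unfolding generated_def by blast
  moreover have "\<Union>\<F> \<in> generated X \<C>" if "\<F> \<subseteq> generated X \<C>" "\<Inter>\<F> \<noteq> {}" for \<F>
    unfolding generated_def
  proof clarify
    fix K assume "connectivity_structure X K" "\<C> \<subseteq> K"
    moreover have "\<F> \<subseteq> K"
      using that(1) calculation unfolding generated_def by blast
    ultimately show "\<Union>\<F> \<in> K"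
      using that(2) unfolding connectivity_structure_def by blast
  qed
  ultimately show ?thesis
    unfolding connectivity_structure_def by (auto simp: generated_def connectivity_structure_def)
qed

definition incl :: "'x set set \<Rightarrow> 'x set rel" where
  "incl K = {(B, A). B \<in> K \<and> A \<in> K \<and> B \<subseteq> A}"

definition sieve :: "'x set set \<Rightarrow> 'x set \<Rightarrow> 'x set set \<Rightarrow> bool" where
  "sieve K A \<sigma> \<longleftrightarrow> \<sigma> \<subseteq> K \<inter> Pow A \<and> (\<forall>B\<in>\<sigma>. K \<inter> Pow B \<subseteq> \<sigma>)"

definition covering_sieves :: "'x set \<Rightarrow> 'x set set \<Rightarrow> 'x set \<Rightarrow> 'x set set set" where
  "covering_sieves X K A = {\<sigma>. sieve K A \<sigma> \<and> generated X \<sigma> = K \<inter> Pow A}"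

text \<open>
  \<open>s\<close> is a matching family for \<open>F\<close> indexed by the members of the sieve \<open>\<sigma>\<close>;
  for \<open>B \<subseteq> A\<close> the restriction map \<open>F A \<rightarrow> F B\<close> is \<open>FAr F A B ()\<close>.
\<close>

definition matching_family ::
  "('x set, 'u) psh \<Rightarrow> 'x set set \<Rightarrow> ('x set \<Rightarrow> 'u) \<Rightarrow> bool" where
  "matching_family F \<sigma> s \<longleftrightarrow>
     (\<forall>B\<in>\<sigma>. s B \<in> FOb F B) \<and> (\<forall>B\<in>\<sigma>. \<forall>C\<in>\<sigma>. C \<subseteq> B \<longrightarrow> FAr F B C () (s B) = s C)"

definition is_sheaf ::
  "'x set set \<Rightarrow> ('x set \<Rightarrow> 'x set set set) \<Rightarrow> ('x set, 'u) psh \<Rightarrow> bool" where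
  "is_sheaf K J F \<longleftrightarrow>
     (\<forall>A\<in>K. \<forall>\<sigma>\<in>J A. \<forall>s. matching_family F \<sigma> s \<longrightarrow>
        (\<exists>!a. a \<in> FOb F A \<and> (\<forall>B\<in>\<sigma>. FAr F A B () a = s B)))"

definition sheaf_cat ::
  "'u set set \<Rightarrow> 'x set \<Rightarrow> 'x set set \<Rightarrow> (('x set, 'u) psh, 'x set \<Rightarrow> 'u \<Rightarrow> 'u) cat" where
  "sheaf_cat U X K = full_subcat (psh_cat U K (incl K)) (is_sheaf K (covering_sieves X K))"


section \<open>The connectivity space of a poset\<close>

definition down :: "'p rel \<Rightarrow> 'p set \<Rightarrow> 'p \<Rightarrow> 'p set" where
  "down r P z = {x \<in> P. (x, z) \<in> r}"

definition poset_connectivity :: "'p set \<Rightarrow> 'p rel \<Rightarrow> 'p set set" where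
  "poset_connectivity P r = generated P {down r P z | z. z \<in> P}"

end

theory Submission
  imports Defs
begin

text \<open>
  Members of \<open>\<L>\<close> are down-closed, so a connected set contains \<open>\<down>z\<close> as soon as it contains \<open>z\<close>,
  and every connected set \<open>B\<close> is generated by the \<open>\<down>z\<close> with \<open>z \<in> B\<close>. Hence a sieve on \<open>B\<close> covers
  if and only if it contains all of these \<open>\<down>z\<close>. In particular \<open>\<down>z\<close> has no covering sieve but the
  maximal one, and a sheaf \<open>F\<close> is determined by its values on the \<open>\<down>z\<close>: \<open>F B\<close> is the limit of the
  \<open>F (\<down>z)\<close>, \<open>z \<in> B\<close>. So restriction of a sheaf along \<open>z \<mapsto> \<down>z\<close> is fully faithful, and it is essentially
  surjective because these limits extend any presheaf on the poset to a sheaf. Finiteness only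
  ensures that the limits are small.
\<close>

section \<open>Categories and functors\<close>

lemma
  assumes "category C"
  shows cat_id: "\<And>x. x \<in> Ob C \<Longrightarrow> Idn C x \<in> Hom C x x"
    and cat_comp: "\<And>x y z f g. x \<in> Ob C \<Longrightarrow> y \<in> Ob C \<Longrightarrow> z \<in> Ob C \<Longrightarrow>
      f \<in> Hom C x y \<Longrightarrow> g \<in> Hom C y z \<Longrightarrow> Comp C x y z g f \<in> Hom C x z"
    and cat_unit_right: "\<And>x y f. x \<in> Ob C \<Longrightarrow> y \<in> Ob C \<Longrightarrow> f \<in> Hom C x y \<Longrightarrow>
      Comp C x x y f (Idn C x) = f"
    and cat_unit_left: "\<And>x y f. x \<in> Ob C \<Longrightarrow> y \<in> Ob C \<Longrightarrow> f \<in> Hom C x y \<Longrightarrow>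
      Comp C x y y (Idn C y) f = f"
    and cat_assoc: "\<And>w x y z f g h. w \<in> Ob C \<Longrightarrow> x \<in> Ob C \<Longrightarrow> y \<in> Ob C \<Longrightarrow> z \<in> Ob C \<Longrightarrow>
      f \<in> Hom C w x \<Longrightarrow> g \<in> Hom C x y \<Longrightarrow> h \<in> Hom C y z \<Longrightarrow>
      Comp C w y z h (Comp C w x y g f) = Comp C w x z (Comp C x y z h g) f"
  using assms unfolding category_def by blast+

lemma
  assumes "is_functor C D F"
  shows functor_ob: "\<And>x. x \<in> Ob C \<Longrightarrow> FOb F x \<in> Ob D"
    and functor_ar: "\<And>x y f. x \<in> Ob C \<Longrightarrow> y \<in> Ob C \<Longrightarrow> f \<in> Hom C x y \<Longrightarrow>
      FAr F x y f \<in> Hom D (FOb F x) (FOb F y)"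
    and functor_id: "\<And>x. x \<in> Ob C \<Longrightarrow> FAr F x x (Idn C x) = Idn D (FOb F x)"
    and functor_comp: "\<And>x y z f g. x \<in> Ob C \<Longrightarrow> y \<in> Ob C \<Longrightarrow> z \<in> Ob C \<Longrightarrow>
      f \<in> Hom C x y \<Longrightarrow> g \<in> Hom C y z \<Longrightarrow> FAr F x z (Comp C x y z g f) =
        Comp D (FOb F x) (FOb F y) (FOb F z) (FAr F y z g) (FAr F x y f)"
    and functor_ob_undefined: "\<And>x. x \<notin> Ob C \<Longrightarrow> FOb F x = undefined"
    and functor_ar_undefined: "\<And>x y f. \<not> (x \<in> Ob C \<and> y \<in> Ob C \<and> f \<in> Hom C x y) \<Longrightarrow>
      FAr F x y f = undefined"
  using assms unfolding is_functor_def by simp_all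

section \<open>Categories built from categories, posets and sets\<close>

lemma category_op_cat: "category C \<Longrightarrow> category (op_cat C)"
  by (simp add: category_def op_cat_def)

lemma category_full_subcat: "category C \<Longrightarrow> category (full_subcat C P)"
  by (simp add: category_def full_subcat_def)

lemma category_set_cat: "category (set_cat U)"
  unfolding category_def set_cat_def
  by (auto simp: compose_assoc Id_compose compose_Id[unfolded restrict_def] restrict_def
      compose_def fun_eq_iff PiE_def extensional_def Pi_def)

lemma category_poset_cat:
  assumes "refl_on P r" "trans r"
  shows "category (poset_cat P r)"
  using assms unfolding category_def poset_cat_def
  by (auto simp: refl_on_def split: if_splits dest: transD)

lemma category_functor_cat:
  assumes C: "category C" and D: "category D"
  shows "category (functor_cat C D)"
proof -
  note id = cat_id[OF D] and comp = cat_comp[OF D] and assoc = cat_assoc[OF D]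
    and unit = cat_unit_left[OF D] cat_unit_right[OF D] and ob = functor_ob and ar = functor_ar
  have idn: "nat_trans C D F F (\<lambda>x\<in>Ob C. Idn D (FOb F x))" if "is_functor C D F" for F
    unfolding nat_trans_def by (simp add: id unit ob[OF that] ar[OF that])
  have cmp: "nat_trans C D F H (\<lambda>x\<in>Ob C. Comp D (FOb F x) (FOb G x) (FOb H x) (s x) (t x))"
    if F: "is_functor C D F" and G: "is_functor C D G" and H: "is_functor C D H"
      and t: "nat_trans C D F G t" and s: "nat_trans C D G H s" for F G H s t
    unfolding nat_trans_def
  proof (intro conjI ballI)
    fix x assume x: "x \<in> Ob C"
    have tx: "t x \<in> Hom D (FOb F x) (FOb G x)" and sx: "s x \<in> Hom D (FOb G x) (FOb H x)"
      using t s x unfolding nat_trans_def by auto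
    then show "(\<lambda>x\<in>Ob C. Comp D (FOb F x) (FOb G x) (FOb H x) (s x) (t x)) x
        \<in> Hom D (FOb F x) (FOb H x)"
      using x by (auto intro: comp ob[OF F] ob[OF G] ob[OF H])
    fix y f assume y: "y \<in> Ob C" and f: "f \<in> Hom C x y"
    have ty: "t y \<in> Hom D (FOb F y) (FOb G y)" and sy: "s y \<in> Hom D (FOb G y) (FOb H y)"
      using t s y unfolding nat_trans_def by auto
    note obs = ob[OF F x] ob[OF F y] ob[OF G x] ob[OF G y] ob[OF H x] ob[OF H y]
    note ars = ar[OF F x y f] ar[OF G x y f] ar[OF H x y f]
    have nt: "Comp D (FOb F x) (FOb F y) (FOb G y) (t y) (FAr F x y f) =
        Comp D (FOb F x) (FOb G x) (FOb G y) (FAr G x y f) (t x)"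
      and ns: "Comp D (FOb G x) (FOb G y) (FOb H y) (s y) (FAr G x y f) =
        Comp D (FOb G x) (FOb H x) (FOb H y) (FAr H x y f) (s x)"
      using t s x y f unfolding nat_trans_def by auto
    have "Comp D (FOb F x) (FOb F y) (FOb H y)
          (Comp D (FOb F y) (FOb G y) (FOb H y) (s y) (t y)) (FAr F x y f)
        = Comp D (FOb F x) (FOb G y) (FOb H y) (s y)
          (Comp D (FOb F x) (FOb F y) (FOb G y) (t y) (FAr F x y f))"
      by (rule assoc[symmetric]) (use obs ars tx ty sx sy in auto)
    also have "\<dots> = Comp D (FOb F x) (FOb G x) (FOb H y)
          (Comp D (FOb G x) (FOb G y) (FOb H y) (s y) (FAr G x y f)) (t x)"
      unfolding nt by (rule assoc) (use obs ars tx ty sx sy in auto)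
    also have "\<dots> = Comp D (FOb F x) (FOb H x) (FOb H y) (FAr H x y f)
          (Comp D (FOb F x) (FOb G x) (FOb H x) (s x) (t x))"
      unfolding ns by (rule assoc[symmetric]) (use obs ars tx ty sx sy in auto)
    finally show "Comp D (FOb F x) (FOb F y) (FOb H y)
          ((\<lambda>x\<in>Ob C. Comp D (FOb F x) (FOb G x) (FOb H x) (s x) (t x)) y) (FAr F x y f)
        = Comp D (FOb F x) (FOb H x) (FOb H y) (FAr H x y f)
          ((\<lambda>x\<in>Ob C. Comp D (FOb F x) (FOb G x) (FOb H x) (s x) (t x)) x)"
      using x y by simp
  qed simp
  show ?thesis
    unfolding category_def functor_cat_def
  \<comment> \<open>The conditionals with value \<open>undefined\<close> in the goals below are what
    the simplifier makes of an inner \<open>restrict\<close> applied to \<open>x\<close>.\<close>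
  proof (simp add: idn cmp, intro conjI allI impI)
    fix F G t assume "is_functor C D F" "is_functor C D G" "nat_trans C D F G t"
    then show "(\<lambda>x\<in>Ob C. Comp D (FOb F x) (FOb F x) (FOb G x) (t x)
          (if x \<in> Ob C then Idn D (FOb F x) else undefined)) = t"
      and "(\<lambda>x\<in>Ob C. Comp D (FOb F x) (FOb G x) (FOb G x)
          (if x \<in> Ob C then Idn D (FOb G x) else undefined) (t x)) = t"
      by (auto simp: fun_eq_iff nat_trans_def extensional_def unit ob)
  next
    fix F G H I t s u
    assume "is_functor C D F" "is_functor C D G" "is_functor C D H" "is_functor C D I"
      "nat_trans C D F G t" "nat_trans C D G H s" "nat_trans C D H I u"
    then show "(\<lambda>x\<in>Ob C. Comp D (FOb F x) (FOb H x) (FOb I x) (u x)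
          (if x \<in> Ob C then Comp D (FOb F x) (FOb G x) (FOb H x) (s x) (t x) else undefined)) =
        (\<lambda>x\<in>Ob C. Comp D (FOb F x) (FOb G x) (FOb I x)
          (if x \<in> Ob C then Comp D (FOb G x) (FOb H x) (FOb I x) (u x) (s x) else undefined) (t x))"
      by (auto simp: fun_eq_iff nat_trans_def assoc ob)
  qed
qed

text \<open>Pointwise inverses of a natural transformation are automatically natural. This lets an
  isomorphism of presheaves be built from bijections, one object at a time.\<close>

lemma nat_iso_imp_is_iso_functor_cat:
  assumes D: "category D" and F: "is_functor C D F" and G: "is_functor C D G"
    and t: "nat_iso C D F G t"
  shows "is_iso (functor_cat C D) F G t"
proof -
  note comp = cat_comp[OF D] and assoc = cat_assoc[OF D]
    and unit = cat_unit_left[OF D] cat_unit_right[OF D]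
  have "\<forall>x\<in>Ob C. \<exists>g\<in>Hom D (FOb G x) (FOb F x).
      Comp D (FOb F x) (FOb G x) (FOb F x) g (t x) = Idn D (FOb F x) \<and>
      Comp D (FOb G x) (FOb F x) (FOb G x) (t x) g = Idn D (FOb G x)"
    using t unfolding nat_iso_def is_iso_def by blast
  then obtain s where s: "\<And>x. x \<in> Ob C \<Longrightarrow> s x \<in> Hom D (FOb G x) (FOb F x) \<and>
      Comp D (FOb F x) (FOb G x) (FOb F x) (s x) (t x) = Idn D (FOb F x) \<and>
      Comp D (FOb G x) (FOb F x) (FOb G x) (t x) (s x) = Idn D (FOb G x)"
    by metis
  have tt: "nat_trans C D F G t" using t unfolding nat_iso_def by blast
  have "nat_trans C D G F (restrict s (Ob C))"
    unfolding nat_trans_def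
  proof (intro conjI ballI)
    fix x assume x: "x \<in> Ob C"
    show "restrict s (Ob C) x \<in> Hom D (FOb G x) (FOb F x)" using x s by simp
    fix y f assume y: "y \<in> Ob C" and f: "f \<in> Hom C x y"
    note obs = functor_ob[OF F x] functor_ob[OF F y] functor_ob[OF G x] functor_ob[OF G y]
    note ars = functor_ar[OF F x y f] functor_ar[OF G x y f]
    have ts: "t x \<in> Hom D (FOb F x) (FOb G x)" "t y \<in> Hom D (FOb F y) (FOb G y)"
      "s x \<in> Hom D (FOb G x) (FOb F x)" "s y \<in> Hom D (FOb G y) (FOb F y)"
      using tt s x y unfolding nat_trans_def by auto
    have nt: "Comp D (FOb F x) (FOb F y) (FOb G y) (t y) (FAr F x y f) =
        Comp D (FOb F x) (FOb G x) (FOb G y) (FAr G x y f) (t x)"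
      using tt x y f unfolding nat_trans_def by auto
    let ?Gx = "FOb G x" and ?Gy = "FOb G y" and ?Fx = "FOb F x" and ?Fy = "FOb F y"
    let ?Ff = "FAr F x y f" and ?Gf = "FAr G x y f"
    \<comment> \<open>Insert the identity as \<open>t x\<close> after \<open>s x\<close>, move
      \<open>?Gf\<close> past \<open>t x\<close> by naturality of \<open>t\<close>, then cancel
      \<open>s y\<close> against \<open>t y\<close>.\<close>
    have "Comp D ?Gx ?Gy ?Fy (s y) ?Gf
        = Comp D ?Gx ?Gy ?Fy (s y) (Comp D ?Gx ?Gx ?Gy ?Gf (Comp D ?Gx ?Fx ?Gx (t x) (s x)))"
      using s[OF x] by (simp add: unit obs ars)
    also have "\<dots> = Comp D ?Gx ?Gy ?Fy (s y) (Comp D ?Gx ?Fx ?Gy (Comp D ?Fx ?Gx ?Gy ?Gf (t x)) (s x))"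
      by (subst assoc) (use obs ars ts in auto)
    also have "\<dots> = Comp D ?Gx ?Fx ?Fy (Comp D ?Fx ?Gy ?Fy (s y) (Comp D ?Fx ?Gx ?Gy ?Gf (t x))) (s x)"
      by (subst assoc) (use obs ars ts comp in auto)
    also have "\<dots> = Comp D ?Gx ?Fx ?Fy (Comp D ?Fx ?Fy ?Fy (Comp D ?Fy ?Gy ?Fy (s y) (t y)) ?Ff) (s x)"
      unfolding nt[symmetric] by (subst assoc) (use obs ars ts in auto)
    also have "\<dots> = Comp D ?Gx ?Fx ?Fy ?Ff (s x)"
      using s[OF y] by (simp add: unit obs ars)
    finally show "Comp D ?Gx ?Gy ?Fy (restrict s (Ob C) y) ?Gf
        = Comp D ?Gx ?Fx ?Fy ?Ff (restrict s (Ob C) x)"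
      using x y by simp
  qed simp
  then show ?thesis
    unfolding is_iso_def functor_cat_def using tt s
    by (auto intro!: bexI[of _ "restrict s (Ob C)"] simp: fun_eq_iff)
qed

text \<open>Arrows of \<open>set_cat\<close> are extensional functions, so a bijection must be
  extensional to be an arrow, and its inverse has to be cut down to \<open>Y\<close>.\<close>

lemma is_iso_set_cat:
  assumes f: "f \<in> extensional X" and b: "bij_betw f X Y"
  shows "is_iso (set_cat U) X Y f"
proof -
  have "f \<in> X \<rightarrow>\<^sub>E Y" using f bij_betwE[OF b] by (auto simp: PiE_def)
  moreover have "(\<lambda>y\<in>Y. inv_into X f y) \<in> Y \<rightarrow>\<^sub>E X"
    using bij_betw_imp_surj_on[OF b] by (auto intro: inv_into_into)
  moreover have "compose X (\<lambda>y\<in>Y. inv_into X f y) f = (\<lambda>x\<in>X. x)"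
    using bij_betw_inv_into_left[OF b] bij_betwE[OF b] by (auto simp: compose_def fun_eq_iff)
  moreover have "compose Y f (\<lambda>y\<in>Y. inv_into X f y) = (\<lambda>y\<in>Y. y)"
    using bij_betw_inv_into_right[OF b] by (auto simp: compose_def fun_eq_iff)
  ultimately show ?thesis
    unfolding is_iso_def set_cat_def by (auto intro!: bexI[of _ "\<lambda>y\<in>Y. inv_into X f y"])
qed

text \<open>A quasi-inverse is assembled by choice: every \<open>d\<close> gets an object
  \<open>g d\<close> with an isomorphism \<open>i d\<close> from \<open>FOb F (g d)\<close> to
  \<open>d\<close>. An arrow of \<open>D\<close> is conjugated by these isomorphisms and then lifted
  to \<open>C\<close> by full faithfulness.\<close>

lemma equivalent_categories_if_fully_faithful:
  assumes C: "category C" and D: "category D" and F: "is_functor C D F"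
    and ff: "\<And>x y. x \<in> Ob C \<Longrightarrow> y \<in> Ob C \<Longrightarrow>
      bij_betw (FAr F x y) (Hom C x y) (Hom D (FOb F x) (FOb F y))"
    and es: "\<And>d. d \<in> Ob D \<Longrightarrow> \<exists>c\<in>Ob C. \<exists>f. is_iso D (FOb F c) d f"
  shows "equivalent_categories D C"
proof -
  note Dc = cat_comp[OF D] and Da = cat_assoc[OF D]
    and Du = cat_unit_left[OF D] cat_unit_right[OF D]
  note Cc = cat_comp[OF C] and Ca = cat_assoc[OF C] and Cid = cat_id[OF C]
  note Fo = functor_ob[OF F] and Fa = functor_ar[OF F]
  have "\<forall>d\<in>Ob D. \<exists>c f g. c \<in> Ob C \<and> f \<in> Hom D (FOb F c) d \<and> g \<in> Hom D d (FOb F c) \<and>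
      Comp D (FOb F c) d (FOb F c) g f = Idn D (FOb F c) \<and> Comp D d (FOb F c) d f g = Idn D d"
    using es unfolding is_iso_def by metis
  then obtain g i j where
    g: "\<And>d. d \<in> Ob D \<Longrightarrow> g d \<in> Ob C" and
    i: "\<And>d. d \<in> Ob D \<Longrightarrow> i d \<in> Hom D (FOb F (g d)) d" and
    j: "\<And>d. d \<in> Ob D \<Longrightarrow> j d \<in> Hom D d (FOb F (g d))" and
    ji: "\<And>d. d \<in> Ob D \<Longrightarrow>
      Comp D (FOb F (g d)) d (FOb F (g d)) (j d) (i d) = Idn D (FOb F (g d))" and
    ij: "\<And>d. d \<in> Ob D \<Longrightarrow> Comp D d (FOb F (g d)) d (i d) (j d) = Idn D d"
    by metis
  \<comment> \<open>\<open>p x y\<close> lifts arrows between images back along \<open>F\<close>: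
    \<open>Fp\<close> expresses fullness, and \<open>Feq\<close> faithfulness.\<close>
  define p where "p x y = inv_into (Hom C x y) (FAr F x y)" for x y
  have pH: "p x y h \<in> Hom C x y" and Fp: "FAr F x y (p x y h) = h"
    if "x \<in> Ob C" "y \<in> Ob C" "h \<in> Hom D (FOb F x) (FOb F y)" for x y h
    using bij_betw_imp_surj_on[OF ff[OF that(1,2)]] that(3) unfolding p_def
    by (auto intro: inv_into_into f_inv_into_f)
  have Feq: "h = k" if "x \<in> Ob C" "y \<in> Ob C" "h \<in> Hom C x y" "k \<in> Hom C x y"
      "FAr F x y h = FAr F x y k" for x y h k
    using bij_betw_imp_inj_on[OF ff[OF that(1,2)]] that(3-5) by (auto dest: inj_onD)
  \<comment> \<open>the arrow \<open>d \<rightarrow> d'\<close> transported along the chosen isomorphisms\<close>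
  define m where "m d d' h = Comp D (FOb F (g d)) d (FOb F (g d')) (Comp D d d' (FOb F (g d')) (j d') h) (i d)"
    for d d' h
  have mH: "m d d' h \<in> Hom D (FOb F (g d)) (FOb F (g d'))"
    if "d \<in> Ob D" "d' \<in> Ob D" "h \<in> Hom D d d'" for d d' h
    unfolding m_def using that g Fo i j by (intro Dc) auto
  have mid: "m d d (Idn D d) = Idn D (FOb F (g d))" if "d \<in> Ob D" for d
    unfolding m_def using that g Fo i j ji Du by simp
  \<comment> \<open>\<open>mi\<close> and \<open>mj\<close> say that \<open>i\<close> and
    \<open>j\<close> are natural with respect to \<open>m\<close>. They yield naturality of the
    counit and of the unit; \<open>mi\<close> also gives the composition law
    \<open>mcomp\<close>.\<close>
  have mi: "Comp D (FOb F (g d)) (FOb F (g d')) d' (i d') (m d d' h) = Comp D (FOb F (g d)) d d' h (i d)"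
    if d: "d \<in> Ob D" "d' \<in> Ob D" and h: "h \<in> Hom D d d'" for d d' h
  proof -
    have "Comp D (FOb F (g d)) (FOb F (g d')) d' (i d') (m d d' h) =
        Comp D (FOb F (g d)) d d' (Comp D d (FOb F (g d')) d' (i d') (Comp D d d' (FOb F (g d')) (j d') h)) (i d)"
      unfolding m_def by (rule Da) (use d h g Fo i j Dc in auto)
    also have "Comp D d (FOb F (g d')) d' (i d') (Comp D d d' (FOb F (g d')) (j d') h) =
        Comp D d d' d' (Comp D d' (FOb F (g d')) d' (i d') (j d')) h"
      by (rule Da) (use d h g Fo i j in auto)
    finally show ?thesis using ij d h Du by simp
  qed
  have mj: "Comp D d (FOb F (g d)) (FOb F (g d')) (m d d' h) (j d) = Comp D d d' (FOb F (g d')) (j d') h"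
    if d: "d \<in> Ob D" "d' \<in> Ob D" and h: "h \<in> Hom D d d'" for d d' h
  proof -
    have "Comp D d (FOb F (g d)) (FOb F (g d')) (m d d' h) (j d) =
        Comp D d d (FOb F (g d')) (Comp D d d' (FOb F (g d')) (j d') h) (Comp D d (FOb F (g d)) d (i d) (j d))"
      unfolding m_def by (rule Da[symmetric]) (use d h g Fo i j Dc in auto)
    then show ?thesis using ij d h Du g Fo j Dc by simp
  qed
  have mcomp: "m d d'' (Comp D d d' d'' k h) =
      Comp D (FOb F (g d)) (FOb F (g d')) (FOb F (g d'')) (m d' d'' k) (m d d' h)"
    if d: "d \<in> Ob D" "d' \<in> Ob D" "d'' \<in> Ob D" and h: "h \<in> Hom D d d'" and k: "k \<in> Hom D d' d''"
    for d d' d'' h k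
  proof -
    let ?a = "FOb F (g d)" and ?b = "FOb F (g d')" and ?c = "FOb F (g d'')"
    have ob: "?a \<in> Ob D" "?b \<in> Ob D" "?c \<in> Ob D" using d g Fo by auto
    have "Comp D ?a ?b ?c (m d' d'' k) (m d d' h) =
        Comp D ?a d' ?c (Comp D d' d'' ?c (j d'') k) (Comp D ?a ?b d' (i d') (m d d' h))"
      unfolding m_def[of d' d'' k] by (rule Da[symmetric]) (use d h k ob i j mH Dc in auto)
    also have "\<dots> = Comp D ?a d' ?c (Comp D d' d'' ?c (j d'') k) (Comp D ?a d d' h (i d))"
      using mi[OF d(1,2) h] by simp
    also have "\<dots> = Comp D ?a d ?c (Comp D d d' ?c (Comp D d' d'' ?c (j d'') k) h) (i d)"
      by (rule Da) (use d h k ob i j Dc in auto)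
    also have "Comp D d d' ?c (Comp D d' d'' ?c (j d'') k) h = Comp D d d'' ?c (j d'') (Comp D d d' d'' k h)"
      by (rule Da[symmetric]) (use d h k ob i j in auto)
    finally show ?thesis unfolding m_def[of d d''] ..
  qed
  define G where "G = \<lparr>FOb = (\<lambda>d. if d \<in> Ob D then g d else undefined),
    FAr = (\<lambda>d d' h. if d \<in> Ob D \<and> d' \<in> Ob D \<and> h \<in> Hom D d d'
      then p (g d) (g d') (m d d' h) else undefined)\<rparr>"
  have GO: "FOb G d = g d" if "d \<in> Ob D" for d using that by (simp add: G_def)
  have GA: "FAr G d d' h = p (g d) (g d') (m d d' h)"
    if "d \<in> Ob D" "d' \<in> Ob D" "h \<in> Hom D d d'" for d d' h
    using that by (simp add: G_def)
  have GH: "p (g d) (g d') (m d d' h) \<in> Hom C (g d) (g d')"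
    and FG: "FAr F (g d) (g d') (p (g d) (g d') (m d d' h)) = m d d' h"
    if "d \<in> Ob D" "d' \<in> Ob D" "h \<in> Hom D d d'" for d d' h
    using that pH Fp g mH by simp_all
  have G: "is_functor D C G"
    unfolding is_functor_def
  proof (intro conjI ballI allI impI)
    fix d assume d: "d \<in> Ob D"
    show "FOb G d \<in> Ob C" using d g GO by simp
    \<comment> \<open>Equations in \<open>C\<close> are checked after applying \<open>F\<close>, by
      \<open>Feq\<close>. There the lifts turn into \<open>m\<close>, which preserves identities and
      composites by \<open>mid\<close> and \<open>mcomp\<close>.\<close>
    show "FAr G d d (Idn D d) = Idn C (FOb G d)"
      using d g GH[of d d "Idn D d"] FG[of d d "Idn D d"] cat_id[OF D] Cid functor_id[OF F] mid
      by (intro Feq[of "g d" "g d"]) (auto simp: GO GA)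
    fix d' h assume d': "d' \<in> Ob D" and h: "h \<in> Hom D d d'"
    show "FAr G d d' h \<in> Hom C (FOb G d) (FOb G d')"
      using d d' h GH by (simp add: GO GA)
    fix d'' k assume d'': "d'' \<in> Ob D" and k: "k \<in> Hom D d' d''"
    have kh: "Comp D d d' d'' k h \<in> Hom D d d''" using d d' d'' h k Dc by blast
    note H = GH[OF d d' h] GH[OF d' d'' k] GH[OF d d'' kh]
    have "FAr F (g d) (g d'') (Comp C (g d) (g d') (g d'') (p (g d') (g d'') (m d' d'' k))
        (p (g d) (g d') (m d d' h))) = m d d'' (Comp D d d' d'' k h)"
      using functor_comp[OF F g[OF d] g[OF d'] g[OF d''] H(1,2)] FG d d' d'' h k mcomp by simp
    then show "FAr G d d'' (Comp D d d' d'' k h) =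
        Comp C (FOb G d) (FOb G d') (FOb G d'') (FAr G d' d'' k) (FAr G d d' h)"
      using d d' d'' h k kh H g Cc FG
      by (intro Feq[of "g d" "g d''"]) (auto simp: GO GA)
  qed (auto simp: G_def)
  have \<eta>: "nat_iso D D (id_functor D) (comp_functor D F G) (restrict j (Ob D))"
    unfolding nat_iso_def nat_trans_def is_iso_def
    using i j ji ij g Fo
    by (auto intro!: bexI[of _ "i x" for x] simp: id_functor_def comp_functor_def GO GA FG mj)
  \<comment> \<open>The counit and its inverse. At \<open>d = FOb F c\<close> both ends of
    \<open>i d\<close> and \<open>j d\<close> are images under \<open>F\<close>, so these arrows can
    be lifted to \<open>C\<close>.\<close>
  define e where "e c = p (g (FOb F c)) c (i (FOb F c))" for c
  define e' where "e' c = p c (g (FOb F c)) (j (FOb F c))" for c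
  have eH: "e c \<in> Hom C (g (FOb F c)) c" "FAr F (g (FOb F c)) c (e c) = i (FOb F c)"
    and e'H: "e' c \<in> Hom C c (g (FOb F c))" "FAr F c (g (FOb F c)) (e' c) = j (FOb F c)"
    if "c \<in> Ob C" for c
    unfolding e_def e'_def using that pH Fp g Fo i j by simp_all
  have ee': "Comp C c (g (FOb F c)) c (e c) (e' c) = Idn C c" if c: "c \<in> Ob C" for c
  proof (rule Feq[OF c c])
    note H = g[OF Fo[OF c]] eH[OF c] e'H[OF c]
    show "FAr F c c (Comp C c (g (FOb F c)) c (e c) (e' c)) = FAr F c c (Idn C c)"
      using functor_comp[OF F c H(1) c H(4,2)] functor_id[OF F c] ij[OF Fo[OF c]] H by simp
    show "Comp C c (g (FOb F c)) c (e c) (e' c) \<in> Hom C c c"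
      by (rule Cc[OF c H(1) c H(4,2)])
  qed (rule Cid[OF c])
  have e'e: "Comp C (g (FOb F c)) c (g (FOb F c)) (e' c) (e c) = Idn C (g (FOb F c))"
    if c: "c \<in> Ob C" for c
  proof (rule Feq[OF g[OF Fo[OF c]] g[OF Fo[OF c]]])
    let ?c = "g (FOb F c)"
    note H = g[OF Fo[OF c]] eH[OF c] e'H[OF c]
    show "FAr F ?c ?c (Comp C ?c c ?c (e' c) (e c)) = FAr F ?c ?c (Idn C ?c)"
      using functor_comp[OF F H(1) c H(1) H(2,4)] functor_id[OF F H(1)] ji[OF Fo[OF c]] H by simp
    show "Comp C ?c c ?c (e' c) (e c) \<in> Hom C ?c ?c"
      by (rule Cc[OF H(1) c H(1) H(2,4)])
    show "Idn C ?c \<in> Hom C ?c ?c" by (rule Cid[OF H(1)])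
  qed
  have enat: "Comp C (g (FOb F c)) (g (FOb F c')) c' (e c')
        (p (g (FOb F c)) (g (FOb F c')) (m (FOb F c) (FOb F c') (FAr F c c' h))) =
      Comp C (g (FOb F c)) c c' h (e c)"
    if c: "c \<in> Ob C" "c' \<in> Ob C" and h: "h \<in> Hom C c c'" for c c' h
  proof (rule Feq)
    note H = GH[OF Fo[OF c(1)] Fo[OF c(2)] Fa[OF c h]]
    show "FAr F (g (FOb F c)) c' (Comp C (g (FOb F c)) (g (FOb F c')) c' (e c')
        (p (g (FOb F c)) (g (FOb F c')) (m (FOb F c) (FOb F c') (FAr F c c' h)))) =
      FAr F (g (FOb F c)) c' (Comp C (g (FOb F c)) c c' h (e c))"
      using c h H eH g Fo Fa functor_comp[OF F] FG mi by simp
  qed (use c h eH g Fo Fa GH Cc in auto)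
  have \<epsilon>: "nat_iso C C (comp_functor C G F) (id_functor C) (restrict e (Ob C))"
    unfolding nat_iso_def nat_trans_def is_iso_def
    using eH e'H ee' e'e enat Fo Fa
    by (auto intro!: bexI[of _ "e' x" for x] simp: id_functor_def comp_functor_def GO GA)
  show ?thesis
    unfolding equivalent_categories_def using C D G F \<eta> \<epsilon> by blast
qed

section \<open>Presheaves\<close>

text \<open>Elementwise form of functoriality. Identities and composites in \<open>set_cat\<close>
  are extensional, so equations between arrows reduce to equations at elements; each hom-set of the
  poset has at most the arrow \<open>()\<close>.\<close>

lemma is_functor_psh_iff:
  assumes r: "refl_on P r" "trans r"
  shows "is_functor (op_cat (poset_cat P r)) (set_cat U) F \<longleftrightarrow>
    (\<forall>x\<in>P. FOb F x \<in> U) \<and>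
    (\<forall>x\<in>P. \<forall>y\<in>P. (y, x) \<in> r \<longrightarrow> FAr F x y () \<in> FOb F x \<rightarrow>\<^sub>E FOb F y) \<and>
    (\<forall>x\<in>P. \<forall>a\<in>FOb F x. FAr F x x () a = a) \<and>
    (\<forall>x\<in>P. \<forall>y\<in>P. \<forall>z\<in>P. (y, x) \<in> r \<longrightarrow> (z, y) \<in> r \<longrightarrow>
      (\<forall>a\<in>FOb F x. FAr F y z () (FAr F x y () a) = FAr F x z () a)) \<and>
    (\<forall>x. x \<notin> P \<longrightarrow> FOb F x = undefined) \<and>
    (\<forall>x y f. \<not> (x \<in> P \<and> y \<in> P \<and> (y, x) \<in> r) \<longrightarrow> FAr F x y f = undefined)"
    (is "?L \<longleftrightarrow> ?R")
proof
  assume L: ?L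
  have ob: "FOb F x \<in> U" if "x \<in> P" for x
    using functor_ob[OF L] that by (simp add: op_cat_def poset_cat_def set_cat_def)
  have ar: "FAr F x y () \<in> FOb F x \<rightarrow>\<^sub>E FOb F y" if "x \<in> P" "y \<in> P" "(y, x) \<in> r" for x y
    using functor_ar[OF L, of x y "()"] that by (simp add: op_cat_def poset_cat_def set_cat_def)
  have id: "FAr F x x () = (\<lambda>a\<in>FOb F x. a)" if "x \<in> P" for x
    using functor_id[OF L, of x] that by (simp add: op_cat_def poset_cat_def set_cat_def)
  have comp: "FAr F x z () = compose (FOb F x) (FAr F y z ()) (FAr F x y ())"
    if "x \<in> P" "y \<in> P" "z \<in> P" "(y, x) \<in> r" "(z, y) \<in> r" for x y z
    using functor_comp[OF L, of x y z "()" "()"] that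
    by (simp add: op_cat_def poset_cat_def set_cat_def)
  have u1: "FOb F x = undefined" if "x \<notin> P" for x
    using functor_ob_undefined[OF L, of x] that by (simp add: op_cat_def poset_cat_def)
  have u2: "FAr F x y f = undefined" if "\<not> (x \<in> P \<and> y \<in> P \<and> (y, x) \<in> r)" for x y f
    using functor_ar_undefined[OF L, of x y f] that by (auto simp: op_cat_def poset_cat_def)
  have "FAr F y z () (FAr F x y () a) = FAr F x z () a"
    if "x \<in> P" "y \<in> P" "z \<in> P" "(y, x) \<in> r" "(z, y) \<in> r" "a \<in> FOb F x" for x y z a
    using comp[OF that(1-5)] that(6) by (simp add: compose_eq)
  then show ?R
    using ob ar u1 u2 id by simp
next
  assume R: ?R
  have ar: "FAr F x y () \<in> FOb F x \<rightarrow>\<^sub>E FOb F y" if "x \<in> P" "y \<in> P" "(y, x) \<in> r" for x y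
    using conjunct1[OF conjunct2[OF R]] that by simp
  have id: "FAr F x x () = (\<lambda>a\<in>FOb F x. a)" if "x \<in> P" for x
  proof (rule extensionalityI[of _ "FOb F x"])
    have "(x, x) \<in> r" using r(1) that unfolding refl_on_def by simp
    then show "FAr F x x () \<in> extensional (FOb F x)" using ar[OF that that] by (simp add: PiE_iff)
  qed (use R that in auto)
  have comp: "FAr F x z () = compose (FOb F x) (FAr F y z ()) (FAr F x y ())"
    if "x \<in> P" "y \<in> P" "z \<in> P" "(y, x) \<in> r" "(z, y) \<in> r" for x y z
  proof (rule extensionalityI[of _ "FOb F x"])
    show "FAr F x z () \<in> extensional (FOb F x)"
      using ar[OF that(1,3) transD[OF r(2) that(5,4)]] by (simp add: PiE_iff)
    fix a assume a: "a \<in> FOb F x"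
    then have "FAr F y z () (FAr F x y () a) = FAr F x z () a" using R that by simp
    then show "FAr F x z () a = compose (FOb F x) (FAr F y z ()) (FAr F x y ()) a"
      using a by (simp add: compose_eq)
  qed simp
  show ?L
    unfolding is_functor_def
    using R id comp by (simp add: op_cat_def poset_cat_def set_cat_def del: split_paired_All)
qed

lemma nat_trans_psh_iff:
  "nat_trans (op_cat (poset_cat P r)) (set_cat U) F G t \<longleftrightarrow>
    t \<in> extensional P \<and> (\<forall>x\<in>P. t x \<in> FOb F x \<rightarrow>\<^sub>E FOb G x) \<and>
    (\<forall>x\<in>P. \<forall>y\<in>P. (y, x) \<in> r \<longrightarrow>
      (\<forall>a\<in>FOb F x. t y (FAr F x y () a) = FAr G x y () (t x a)))"
  unfolding nat_trans_def
  by (auto simp: op_cat_def poset_cat_def set_cat_def compose_def fun_eq_iff split: if_splits)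

lemma psh_cat_simps:
  "Ob (psh_cat U P r) = {F. is_functor (op_cat (poset_cat P r)) (set_cat U) F}"
  "Hom (psh_cat U P r) F G = {t. nat_trans (op_cat (poset_cat P r)) (set_cat U) F G t}"
  "Idn (psh_cat U P r) F = (\<lambda>x\<in>P. \<lambda>a\<in>FOb F x. a)"
  "Comp (psh_cat U P r) F G H s t = (\<lambda>x\<in>P. compose (FOb F x) (s x) (t x))"
  by (simp_all add: psh_cat_def functor_cat_def op_cat_def poset_cat_def set_cat_def)

lemma sheaf_cat_simps:
  "Ob (sheaf_cat U X L) = {F. is_functor (op_cat (poset_cat L (incl L))) (set_cat U) F \<and>
    is_sheaf L (covering_sieves X L) F}"
  "Hom (sheaf_cat U X L) F G = {t. nat_trans (op_cat (poset_cat L (incl L))) (set_cat U) F G t}"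
  "Idn (sheaf_cat U X L) F = (\<lambda>x\<in>L. \<lambda>a\<in>FOb F x. a)"
  "Comp (sheaf_cat U X L) F G H s t = (\<lambda>x\<in>L. compose (FOb F x) (s x) (t x))"
  by (simp_all add: sheaf_cat_def full_subcat_def psh_cat_simps)

lemma category_psh_cat:
  assumes "refl_on P r" "trans r"
  shows "category (psh_cat U P r)"
  unfolding psh_cat_def
  by (intro category_functor_cat category_op_cat category_set_cat category_poset_cat assms)

lemma refl_on_incl: "refl_on L (incl L)" and trans_incl: "trans (incl L)"
  by (auto simp: refl_on_def trans_def incl_def)

lemma category_sheaf_cat: "category (sheaf_cat U X L)"
  unfolding sheaf_cat_def
  by (intro category_full_subcat category_psh_cat refl_on_incl trans_incl)

lemma
  assumes "is_functor (op_cat (poset_cat P r)) (set_cat U) F" "refl_on P r" "trans r"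
  shows psh_ob: "\<And>x. x \<in> P \<Longrightarrow> FOb F x \<in> U"
    and psh_ar: "\<And>x y. x \<in> P \<Longrightarrow> y \<in> P \<Longrightarrow> (y, x) \<in> r \<Longrightarrow> FAr F x y () \<in> FOb F x \<rightarrow>\<^sub>E FOb F y"
    and psh_in: "\<And>x y a. x \<in> P \<Longrightarrow> y \<in> P \<Longrightarrow> (y, x) \<in> r \<Longrightarrow> a \<in> FOb F x \<Longrightarrow>
      FAr F x y () a \<in> FOb F y"
    and psh_id: "\<And>x a. x \<in> P \<Longrightarrow> a \<in> FOb F x \<Longrightarrow> FAr F x x () a = a"
    and psh_comp: "\<And>x y z a. x \<in> P \<Longrightarrow> y \<in> P \<Longrightarrow> z \<in> P \<Longrightarrow> (y, x) \<in> r \<Longrightarrow> (z, y) \<in> r \<Longrightarrow>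
      a \<in> FOb F x \<Longrightarrow> FAr F y z () (FAr F x y () a) = FAr F x z () a"
  using assms(1) unfolding is_functor_psh_iff[OF assms(2,3)]
  by (simp_all add: PiE_iff)

lemma
  assumes "is_functor (op_cat (poset_cat L (incl L))) (set_cat U) F"
  shows psh_incl_ob: "\<And>B. B \<in> L \<Longrightarrow> FOb F B \<in> U"
    and psh_incl_ar: "\<And>B C. B \<in> L \<Longrightarrow> C \<in> L \<Longrightarrow> C \<subseteq> B \<Longrightarrow> FAr F B C () \<in> FOb F B \<rightarrow>\<^sub>E FOb F C"
    and psh_incl_in: "\<And>B C b. B \<in> L \<Longrightarrow> C \<in> L \<Longrightarrow> C \<subseteq> B \<Longrightarrow> b \<in> FOb F B \<Longrightarrow> FAr F B C () b \<in> FOb F C"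
    and psh_incl_id: "\<And>B b. B \<in> L \<Longrightarrow> b \<in> FOb F B \<Longrightarrow> FAr F B B () b = b"
    and psh_incl_comp: "\<And>B C D b. B \<in> L \<Longrightarrow> C \<in> L \<Longrightarrow> D \<in> L \<Longrightarrow> C \<subseteq> B \<Longrightarrow> D \<subseteq> C \<Longrightarrow> b \<in> FOb F B \<Longrightarrow>
      FAr F C D () (FAr F B C () b) = FAr F B D () b"
  using psh_ob[OF assms refl_on_incl trans_incl] psh_ar[OF assms refl_on_incl trans_incl]
    psh_in[OF assms refl_on_incl trans_incl] psh_id[OF assms refl_on_incl trans_incl]
    psh_comp[OF assms refl_on_incl trans_incl]
  by (simp_all add: incl_def)

lemma is_sheafD:
  assumes "is_sheaf L J F" "B \<in> L" "\<sigma> \<in> J B" "matching_family F \<sigma> s"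
  shows "\<exists>!a. a \<in> FOb F B \<and> (\<forall>S\<in>\<sigma>. FAr F B S () a = s S)"
  using assms unfolding is_sheaf_def by simp

text \<open>A limit consists of functions, which are not elements of type \<open>'u\<close>; this
  lemma supplies a copy of the ambient product inside \<open>U\<close>. The empty product is coded
  by a singleton, a subset of a nonempty member of \<open>U\<close>, and each further index costs
  one binary product, available in \<open>U\<close> up to bijection.\<close>

lemma finite_PiE_embeds:
  assumes U: "set_universe U" and "finite I" and "\<And>i. i \<in> I \<Longrightarrow> X i \<in> U"
  shows "\<exists>e. inj_on e (Pi\<^sub>E I X) \<and> e ` Pi\<^sub>E I X \<in> U"
  using assms(2,3)
proof (induction I rule: finite_induct)
  case empty
  have "\<exists>N\<in>U. N \<noteq> {}" using U unfolding set_universe_def by simp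
  then obtain N a where "N \<in> U" "a \<in> N" by blast
  then have "{a} \<in> U" using U unfolding set_universe_def by simp
  then show ?case by (intro exI[of _ "\<lambda>_. a"]) simp
next
  case (insert x I)
  then obtain e where e: "inj_on e (Pi\<^sub>E I X)" "e ` Pi\<^sub>E I X \<in> U" by auto
  moreover have "X x \<in> U" using insert.prems by simp
  ultimately obtain C where "C \<in> U" "C \<approx> X x \<times> e ` Pi\<^sub>E I X"
    using U unfolding set_universe_def by metis
  then obtain h where h: "bij_betw h (X x \<times> e ` Pi\<^sub>E I X) C"
    using eqpoll_sym unfolding eqpoll_def by blast
  \<comment> \<open>The code of a family pairs its value at the new index with the code of its
    restriction to \<open>I\<close>, and \<open>h\<close> carries such pairs into
    \<open>C\<close>.\<close>
  define k where "k s = h (s x, e (restrict s I))" for s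
  have mem: "s x \<in> X x" "restrict s I \<in> Pi\<^sub>E I X" if "s \<in> Pi\<^sub>E (insert x I) X" for s
    using that by auto
  have "k ` Pi\<^sub>E (insert x I) X \<subseteq> C"
    using bij_betwE[OF h] mem unfolding k_def by blast
  then have "k ` Pi\<^sub>E (insert x I) X \<in> U"
    using U \<open>C \<in> U\<close> unfolding set_universe_def by blast
  moreover have "inj_on k (Pi\<^sub>E (insert x I) X)"
  proof (rule inj_onI)
    fix s t assume s: "s \<in> Pi\<^sub>E (insert x I) X" and t: "t \<in> Pi\<^sub>E (insert x I) X" and "k s = k t"
    then have "(s x, e (restrict s I)) = (t x, e (restrict t I))"
      using bij_betw_imp_inj_on[OF h] mem[OF s] mem[OF t] unfolding k_def by (auto dest!: inj_onD)
    then have "s x = t x" "restrict s I = restrict t I"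
      using inj_onD[OF e(1) _ mem(2)[OF s] mem(2)[OF t]] by auto
    then have "s i = t i" if "i \<in> insert x I" for i
      using that by (metis insertE restrict_apply')
    then show "s = t" using s t by (intro PiE_ext) auto
  qed
  ultimately show ?case by blast
qed

section \<open>Covering sieves in the connectivity space of a poset\<close>

text \<open>The induction principle for generated structures: a property holds for all members once
  the sets having it form a connectivity structure containing the generators.\<close>

lemma generated_least:
  "connectivity_structure X L \<Longrightarrow> \<C> \<subseteq> L \<Longrightarrow> generated X \<C> \<subseteq> L"
  unfolding generated_def by blast

lemma generated_superset: "\<C> \<subseteq> generated X \<C>"
  unfolding generated_def by blast

lemma connectivity_structureI:
  assumes "L \<subseteq> Pow X" "{} \<in> L"
    and "\<And>\<F>. \<F> \<subseteq> L \<Longrightarrow> \<Inter>\<F> \<noteq> {} \<Longrightarrow> \<Union>\<F> \<in> L"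
  shows "connectivity_structure X L"
  using assms unfolding connectivity_structure_def by blast

lemma connectivity_structureD:
  assumes "connectivity_structure X L"
  shows "L \<subseteq> Pow X" "{} \<in> L" "\<And>\<F>. \<F> \<subseteq> L \<Longrightarrow> \<Inter>\<F> \<noteq> {} \<Longrightarrow> \<Union>\<F> \<in> L"
  using assms unfolding connectivity_structure_def by auto

text \<open>Serves as an upper bound: a sieve on \<open>B\<close> consists of connected subsets of
  \<open>B\<close>, hence so does everything that it generates.\<close>

lemma connectivity_structure_restrict:
  assumes "connectivity_structure X L"
  shows "connectivity_structure X (L \<inter> Pow B)"
proof (rule connectivity_structureI)
  fix \<F> assume "\<F> \<subseteq> L \<inter> Pow B" "\<Inter>\<F> \<noteq> {}"
  moreover from this have "\<Union>\<F> \<in> L" by (intro connectivity_structureD(3)[OF assms]) auto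
  ultimately show "\<Union>\<F> \<in> L \<inter> Pow B" by auto
qed (use connectivity_structureD(1,2)[OF assms] in auto)

locale preordered_set =
  fixes A :: "'a set" and r :: "'a rel"
  assumes preorder: "preorder_on A r"
begin

abbreviation dn :: "'a \<Rightarrow> 'a set" where "dn \<equiv> down r A"
abbreviation K :: "'a set set" where "K \<equiv> poset_connectivity A r"

lemma r_refl: "refl_on A r" and r_trans: "trans r"
  using preorder unfolding preorder_on_def by auto

lemma r_in: "(x, y) \<in> r \<Longrightarrow> x \<in> A" "(x, y) \<in> r \<Longrightarrow> y \<in> A"
  using preorder unfolding preorder_on_def by auto

lemma in_dn_iff: "x \<in> dn z \<longleftrightarrow> (x, z) \<in> r"
  using r_in unfolding down_def by auto

lemma in_dn_self: "z \<in> A \<Longrightarrow> z \<in> dn z"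
  using r_refl by (simp add: in_dn_iff refl_on_def)

lemma dn_mono: "(w, z) \<in> r \<Longrightarrow> dn w \<subseteq> dn z"
  using transD[OF r_trans] by (auto simp: in_dn_iff)

lemma connectivity_structure_K: "connectivity_structure A K"
  unfolding poset_connectivity_def
  by (rule connectivity_structure_generated) (auto simp: down_def)

lemma dn_in_K: "z \<in> A \<Longrightarrow> dn z \<in> K"
  unfolding poset_connectivity_def by (rule subsetD[OF generated_superset]) blast

lemma subset_if_in_K: "B \<in> K \<Longrightarrow> B \<subseteq> A"
  using connectivity_structureD(1)[OF connectivity_structure_K] by blast

text \<open>The down-closed subsets of \<open>A\<close> are stable under all unions, so they form a
  connectivity structure. It contains every \<open>dn z\<close> by transitivity, hence all of
  \<open>K\<close>.\<close>

lemma down_closed_if_in_K: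
  assumes "B \<in> K" "x \<in> B" "(y, x) \<in> r"
  shows "y \<in> B"
proof -
  have "K \<subseteq> {B. B \<subseteq> A \<and> (\<forall>x\<in>B. \<forall>y. (y, x) \<in> r \<longrightarrow> y \<in> B)}"
    unfolding poset_connectivity_def
  proof (rule generated_least)
    show "{down r A z |z. z \<in> A} \<subseteq> {B. B \<subseteq> A \<and> (\<forall>x\<in>B. \<forall>y. (y, x) \<in> r \<longrightarrow> y \<in> B)}"
      using transD[OF r_trans] r_in(1) by (auto simp: in_dn_iff)
  next
    show "connectivity_structure A {B. B \<subseteq> A \<and> (\<forall>x\<in>B. \<forall>y. (y, x) \<in> r \<longrightarrow> y \<in> B)}" (is "connectivity_structure A ?L")
    proof (rule connectivity_structureI)
      fix \<F> assume F: "\<F> \<subseteq> ?L"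
      show "\<Union>\<F> \<in> ?L"
      proof (intro CollectI conjI ballI allI impI)
        fix x y assume "x \<in> \<Union>\<F>" "(y, x) \<in> r"
        then show "y \<in> \<Union>\<F>" using F by blast
      qed (use F in blast)
    qed auto
  qed
  then show ?thesis using assms by blast
qed

lemma dn_subset: "B \<in> K \<Longrightarrow> z \<in> B \<Longrightarrow> dn z \<subseteq> B"
  using down_closed_if_in_K by (auto simp: in_dn_iff)

text \<open>By minimality of \<open>K\<close>: the subsets of \<open>A\<close> generated by their
  own principal down-sets form a connectivity structure. It contains \<open>dn z\<close>, because
  \<open>z \<in> dn z\<close> makes \<open>dn z\<close> one of its own generators.\<close>

lemma in_generated_dn_if_in_K:
  assumes "B \<in> K"
  shows "B \<in> generated A (dn ` B)"
proof -
  let ?L = "{B. B \<subseteq> A \<and> B \<in> generated A (dn ` B)}"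
  have mono: "generated A \<C> \<subseteq> generated A \<D>" if "\<C> \<subseteq> \<D>" for \<C> \<D> :: "'a set set"
    using that unfolding generated_def by blast
  have gen: "connectivity_structure A (generated A (dn ` B))" for B
    by (rule connectivity_structure_generated) (auto simp: down_def)
  have "K \<subseteq> ?L"
    unfolding poset_connectivity_def
  proof (rule generated_least)
    have "dn z \<in> generated A (dn ` dn z)" if "z \<in> A" for z
      using generated_superset in_dn_self[OF that] by blast
    then show "{down r A z |z. z \<in> A} \<subseteq> ?L"
      using r_in by (auto simp: in_dn_iff)
    have "\<Union>\<F> \<in> generated A (dn ` \<Union>\<F>)" if "\<F> \<subseteq> ?L" "\<Inter>\<F> \<noteq> {}" for \<F>
    proof -
      \<comment> \<open>Enlarging the family of generators moves all members of \<open>\<F>\<close>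
        into one common structure, which is closed under unions with a common point.\<close>
      have "\<F> \<subseteq> generated A (dn ` \<Union>\<F>)"
      proof
        fix B assume "B \<in> \<F>"
        then have "B \<in> generated A (dn ` B)" "dn ` B \<subseteq> dn ` \<Union>\<F>" using that(1) by auto
        then show "B \<in> generated A (dn ` \<Union>\<F>)" using mono by blast
      qed
      then show ?thesis using that(2) by (rule connectivity_structureD(3)[OF gen])
    qed
    moreover have "{} \<in> generated A (dn ` {})"
      by (rule connectivity_structureD(2)[OF gen])
    ultimately show "connectivity_structure A ?L"
      by (intro connectivity_structureI) auto
  qed
  then show ?thesis using assms by blast
qed

text \<open>If \<open>\<sigma>\<close> covers, each \<open>z \<in> B\<close> lies in some
  \<open>S \<in> \<sigma>\<close>; then \<open>dn z \<subseteq> S\<close> is connected and belongs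
  to the sieve. Conversely, every connected \<open>C \<subseteq> B\<close> is generated by the
  \<open>dn z\<close> with \<open>z \<in> C\<close>, all of which are in
  \<open>\<sigma>\<close>.\<close>

lemma covering_sieves_iff:
  assumes B: "B \<in> K"
  shows "\<sigma> \<in> covering_sieves A K B \<longleftrightarrow> sieve K B \<sigma> \<and> (\<forall>z\<in>B. dn z \<in> \<sigma>)"
proof (intro iffI conjI ballI)
  assume \<sigma>: "\<sigma> \<in> covering_sieves A K B"
  then show sv: "sieve K B \<sigma>" by (simp add: covering_sieves_def)
  have gen: "generated A \<sigma> = K \<inter> Pow B" using \<sigma> by (simp add: covering_sieves_def)
  fix z assume z: "z \<in> B"
  then have zA: "z \<in> A" using B subset_if_in_K by blast
  \<comment> \<open>A power set is a connectivity structure, so generation creates no points outside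
    \<open>\<Union>\<sigma>\<close>; since \<open>B\<close> is generated, \<open>\<sigma>\<close>
    must reach every point of \<open>B\<close>.\<close>
  have "generated A \<sigma> \<subseteq> Pow (A \<inter> \<Union>\<sigma>)"
  proof (rule generated_least)
    show "\<sigma> \<subseteq> Pow (A \<inter> \<Union>\<sigma>)"
      using sv subset_if_in_K unfolding sieve_def by blast
  qed (rule connectivity_structureI; auto)
  then obtain S where S: "S \<in> \<sigma>" "z \<in> S"
    using gen B z by blast
  then have "dn z \<in> K \<inter> Pow S"
    using sv dn_in_K[OF zA] dn_subset unfolding sieve_def by blast
  then show "dn z \<in> \<sigma>" using S(1) sv unfolding sieve_def by blast
next
  assume "sieve K B \<sigma> \<and> (\<forall>z\<in>B. dn z \<in> \<sigma>)"
  then have sv: "sieve K B \<sigma>" and dn: "\<And>z. z \<in> B \<Longrightarrow> dn z \<in> \<sigma>" by auto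
  have "generated A \<sigma> \<subseteq> K \<inter> Pow B"
    by (rule generated_least)
      (use sv in \<open>auto simp: sieve_def intro: connectivity_structure_restrict connectivity_structure_K\<close>)
  moreover have "C \<in> generated A \<sigma>" if "C \<in> K" "C \<subseteq> B" for C
  proof -
    have "dn ` C \<subseteq> \<sigma>" using dn that by auto
    then have "generated A (dn ` C) \<subseteq> generated A \<sigma>" unfolding generated_def by blast
    then show ?thesis using in_generated_dn_if_in_K[OF that(1)] by blast
  qed
  ultimately show "\<sigma> \<in> covering_sieves A K B"
    using sv unfolding covering_sieves_def by blast
qed

section \<open>Restriction of sheaves to principal down-sets\<close>

text \<open>The sieve \<open>?\<sigma>\<close> of connected sets below some \<open>dn z\<close> with
  \<open>z \<in> B\<close> is the least covering sieve of \<open>B\<close>, and \<open>b\<close> and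
  \<open>b'\<close> amalgamate the same matching family on it. For \<open>B = {}\<close> this sieve
  is empty, so that \<open>FOb F {}\<close> has at most one element.\<close>

lemma sheaf_separated:
  assumes F: "is_functor (op_cat (poset_cat K (incl K))) (set_cat U) F"
    and sh: "is_sheaf K (covering_sieves A K) F"
    and B: "B \<in> K" and b: "b \<in> FOb F B" and b': "b' \<in> FOb F B"
    and eq: "\<And>z. z \<in> B \<Longrightarrow> FAr F B (dn z) () b = FAr F B (dn z) () b'"
  shows "b = b'"
proof -
  let ?\<sigma> = "{S \<in> K. \<exists>z\<in>B. S \<subseteq> dn z}"
  have sub: "S \<subseteq> B" if "S \<in> ?\<sigma>" for S
    using that dn_subset[OF B] by blast
  have A: "z \<in> A" if "z \<in> B" for z using subset_if_in_K[OF B] that by blast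
  have "sieve K B ?\<sigma>" unfolding sieve_def using sub by blast
  moreover have "\<forall>z\<in>B. dn z \<in> ?\<sigma>" using A dn_in_K by blast
  ultimately have \<sigma>: "?\<sigma> \<in> covering_sieves A K B" using covering_sieves_iff[OF B] by blast
  have "matching_family F ?\<sigma> (\<lambda>S. FAr F B S () b)"
    unfolding matching_family_def using sub b B psh_incl_in[OF F] psh_incl_comp[OF F] by simp
  from is_sheafD[OF sh B \<sigma> this]
  have ex1: "\<exists>!a. a \<in> FOb F B \<and> (\<forall>S\<in>?\<sigma>. FAr F B S () a = FAr F B S () b)" .
  have "FAr F B S () b' = FAr F B S () b" if S: "S \<in> ?\<sigma>" for S
  proof -
    obtain z where z: "z \<in> B" "S \<subseteq> dn z" and SK: "S \<in> K" using S by blast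
    show ?thesis
      using psh_incl_comp[OF F B dn_in_K[OF A[OF z(1)]] SK dn_subset[OF B z(1)] z(2)] b b' eq[OF z(1)]
      by metis
  qed
  then show ?thesis using ex1 b b' by blast
qed

text \<open>Values on the \<open>dn z\<close> alone suffice for gluing: restricting them downwards
  gives a matching family on the least covering sieve of \<open>B\<close>.\<close>

lemma sheaf_amalgamation:
  assumes F: "is_functor (op_cat (poset_cat K (incl K))) (set_cat U) F"
    and sh: "is_sheaf K (covering_sieves A K) F"
    and B: "B \<in> K" and g: "\<And>z. z \<in> B \<Longrightarrow> g z \<in> FOb F (dn z)"
    and gc: "\<And>z w. z \<in> B \<Longrightarrow> (w, z) \<in> r \<Longrightarrow> FAr F (dn z) (dn w) () (g z) = g w"
  shows "\<exists>b\<in>FOb F B. \<forall>z\<in>B. FAr F B (dn z) () b = g z"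
proof -
  let ?\<sigma> = "{S \<in> K. \<exists>z\<in>B. S \<subseteq> dn z}"
  have sub: "S \<subseteq> B" if "S \<in> ?\<sigma>" for S
    using that dn_subset[OF B] by blast
  have A: "z \<in> A" if "z \<in> B" for z using subset_if_in_K[OF B] that by blast
  have "sieve K B ?\<sigma>" unfolding sieve_def using sub by blast
  moreover have dn\<sigma>: "\<forall>z\<in>B. dn z \<in> ?\<sigma>" using A dn_in_K by blast
  ultimately have \<sigma>: "?\<sigma> \<in> covering_sieves A K B" using covering_sieves_iff[OF B] by blast
  \<comment> \<open>\<open>S\<close> may lie below both \<open>dn z\<close> and
    \<open>dn z'\<close>, and no connected set between need be available for comparison. The two
    values are therefore compared inside \<open>S\<close>: on each \<open>dn w\<close> with
    \<open>w \<in> S\<close> both restrict to \<open>g w\<close>.\<close>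
  have indep: "FAr F (dn z) S () (g z) = FAr F (dn z') S () (g z')"
    if z: "z \<in> B" "S \<subseteq> dn z" and z': "z' \<in> B" "S \<subseteq> dn z'" and S: "S \<in> K" for z z' S
  proof (rule sheaf_separated[OF F sh S])
    have "FAr F S (dn w) () (FAr F (dn y) S () (g y)) = g w"
      if "w \<in> S" "y \<in> B" "S \<subseteq> dn y" for w y
    proof -
      have wA: "w \<in> A" using subset_if_in_K[OF S] that by blast
      have "(w, y) \<in> r" using that by (auto simp: in_dn_iff)
      then show ?thesis
        using psh_incl_comp[OF F dn_in_K[OF A[OF that(2)]] S dn_in_K[OF wA] that(3) dn_subset[OF S that(1)]
            g[OF that(2)]] gc that(2) by simp
    qed
    then show "FAr F S (dn w) () (FAr F (dn z) S () (g z)) =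
        FAr F S (dn w) () (FAr F (dn z') S () (g z'))" if "w \<in> S" for w
      using that z z' by simp
  qed (use z z' S A dn_in_K g psh_incl_in[OF F] in auto)
  \<comment> \<open>\<open>S\<close> may lie below several \<open>z\<close>; the choice is immaterial by \<open>indep\<close>\<close>
  define s where "s S = (let z = (SOME z. z \<in> B \<and> S \<subseteq> dn z) in FAr F (dn z) S () (g z))" for S
  have s: "s S = FAr F (dn z) S () (g z)" if "z \<in> B" "S \<subseteq> dn z" "S \<in> K" for z S
  proof -
    have "(SOME z. z \<in> B \<and> S \<subseteq> dn z) \<in> B \<and> S \<subseteq> dn (SOME z. z \<in> B \<and> S \<subseteq> dn z)"
      by (rule someI[of _ z]) (use that in simp)
    then show ?thesis unfolding s_def Let_def using that by (intro indep) auto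
  qed
  have "matching_family F ?\<sigma> s"
    unfolding matching_family_def
  proof (intro conjI ballI impI)
    fix S assume "S \<in> ?\<sigma>"
    then obtain z where z: "z \<in> B" "S \<subseteq> dn z" "S \<in> K" by blast
    show "s S \<in> FOb F S"
      unfolding s[OF z] by (rule psh_incl_in[OF F dn_in_K[OF A[OF z(1)]] z(3,2) g[OF z(1)]])
    fix T assume "T \<in> ?\<sigma>" and TS: "T \<subseteq> S"
    then have T: "T \<in> K" "T \<subseteq> dn z" using z(2) by auto
    show "FAr F S T () (s S) = s T"
      unfolding s[OF z] s[OF z(1) T(2,1)]
      by (rule psh_incl_comp[OF F dn_in_K[OF A[OF z(1)]] z(3) T(1) z(2) TS g[OF z(1)]])
  qed
  from is_sheafD[OF sh B \<sigma> this]
  obtain b where b: "b \<in> FOb F B" "\<And>S. S \<in> ?\<sigma> \<Longrightarrow> FAr F B S () b = s S"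
    by blast
  have "FAr F B (dn z) () b = g z" if z: "z \<in> B" for z
    using b(2)[of "dn z"] dn\<sigma> z s[OF z order_refl dn_in_K[OF A[OF z]]]
      psh_incl_id[OF F dn_in_K[OF A[OF z]] g[OF z]] by simp
  then show ?thesis using b(1) by blast
qed

section \<open>Precomposition with \<open>z \<mapsto> dn z\<close> as a fully faithful
  functor\<close>

definition restr_ob :: "('a set, 'u) psh \<Rightarrow> ('a, 'u) psh" where
  "restr_ob F =
     \<lparr>FOb = (\<lambda>z. if z \<in> A then FOb F (dn z) else undefined),
      FAr = (\<lambda>x y f. if (y, x) \<in> r then FAr F (dn x) (dn y) () else undefined)\<rparr>"

lemma restr_ob_simps [simp]:
  "z \<in> A \<Longrightarrow> FOb (restr_ob F) z = FOb F (dn z)"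
  "(y, x) \<in> r \<Longrightarrow> FAr (restr_ob F) x y f = FAr F (dn x) (dn y) ()"
  by (simp_all add: restr_ob_def)

lemma is_functor_restr_ob:
  assumes F: "is_functor (op_cat (poset_cat K (incl K))) (set_cat U) F"
  shows "is_functor (op_cat (poset_cat A r)) (set_cat U) (restr_ob F)"
  unfolding is_functor_psh_iff[OF r_refl r_trans]
proof (intro conjI ballI allI impI)
  fix x assume x: "x \<in> A"
  show "FOb (restr_ob F) x \<in> U" using psh_incl_ob[OF F] x dn_in_K by simp
  have "(x, x) \<in> r" using x r_refl by (simp add: refl_on_def)
  then show "FAr (restr_ob F) x x () a = a" if "a \<in> FOb (restr_ob F) x" for a
    using that x psh_incl_id[OF F dn_in_K[OF x]] by simp
  fix y assume y: "y \<in> A" and yx: "(y, x) \<in> r"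
  show "FAr (restr_ob F) x y () \<in> FOb (restr_ob F) x \<rightarrow>\<^sub>E FOb (restr_ob F) y"
    using psh_incl_ar[OF F dn_in_K[OF x] dn_in_K[OF y] dn_mono[OF yx]] x y yx by simp
  fix z a assume z: "z \<in> A" and zy: "(z, y) \<in> r" and a: "a \<in> FOb (restr_ob F) x"
  show "FAr (restr_ob F) y z () (FAr (restr_ob F) x y () a) = FAr (restr_ob F) x z () a"
    using psh_incl_comp[OF F dn_in_K[OF x] dn_in_K[OF y] dn_in_K[OF z] dn_mono[OF yx] dn_mono[OF zy]]
      a x yx zy transD[OF r_trans zy yx] by simp
qed (use r_in in \<open>auto simp: restr_ob_def\<close>)

definition restr :: "'u set set \<Rightarrow>
    (('a set, 'u) psh, 'a set \<Rightarrow> 'u \<Rightarrow> 'u, ('a, 'u) psh, 'a \<Rightarrow> 'u \<Rightarrow> 'u) cfun" where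
  "restr U =
     \<lparr>FOb = (\<lambda>F. if F \<in> Ob (sheaf_cat U A K) then restr_ob F else undefined),
      FAr = (\<lambda>F G t. if F \<in> Ob (sheaf_cat U A K) \<and> G \<in> Ob (sheaf_cat U A K) \<and>
          t \<in> Hom (sheaf_cat U A K) F G
        then (\<lambda>z\<in>A. t (dn z)) else undefined)\<rparr>"

lemma restr_simps:
  "F \<in> Ob (sheaf_cat U A K) \<Longrightarrow> FOb (restr U) F = restr_ob F"
  "F \<in> Ob (sheaf_cat U A K) \<Longrightarrow> G \<in> Ob (sheaf_cat U A K) \<Longrightarrow> t \<in> Hom (sheaf_cat U A K) F G \<Longrightarrow>
    FAr (restr U) F G t = (\<lambda>z\<in>A. t (dn z))"
  by (simp_all add: restr_def)

lemma nat_trans_incl_iff: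
  "nat_trans (op_cat (poset_cat K (incl K))) (set_cat U) F G t \<longleftrightarrow>
    t \<in> extensional K \<and> (\<forall>B\<in>K. t B \<in> FOb F B \<rightarrow>\<^sub>E FOb G B) \<and>
    (\<forall>B\<in>K. \<forall>C\<in>K. C \<subseteq> B \<longrightarrow> (\<forall>a\<in>FOb F B. t C (FAr F B C () a) = FAr G B C () (t B a)))"
  unfolding nat_trans_psh_iff by (simp add: incl_def)

lemma is_functor_restr: "is_functor (sheaf_cat U A K) (psh_cat U A r) (restr U)"
  unfolding is_functor_def
proof (intro conjI ballI allI impI)
  fix F assume F: "F \<in> Ob (sheaf_cat U A K)"
  show "FOb (restr U) F \<in> Ob (psh_cat U A r)"
    using F by (auto intro: is_functor_restr_ob simp: restr_simps(1) psh_cat_simps sheaf_cat_simps)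
  \<comment> \<open>Membership in the hom-set comes first, since \<open>FAr (restr U)\<close> is
    \<open>undefined\<close> elsewhere; composites below are treated likewise.\<close>
  have "Idn (sheaf_cat U A K) F \<in> Hom (sheaf_cat U A K) F F"
    using cat_id[OF category_sheaf_cat F] .
  then show "FAr (restr U) F F (Idn (sheaf_cat U A K) F) = Idn (psh_cat U A r) (FOb (restr U) F)"
    using F dn_in_K
    by (auto simp: restr_simps sheaf_cat_simps(3) psh_cat_simps(3) cong: restrict_cong)
  fix G t assume G: "G \<in> Ob (sheaf_cat U A K)" and t: "t \<in> Hom (sheaf_cat U A K) F G"
  show "FAr (restr U) F G t \<in> Hom (psh_cat U A r) (FOb (restr U) F) (FOb (restr U) G)"
    using t dn_in_K dn_mono
    unfolding restr_simps(1)[OF F] restr_simps(1)[OF G] restr_simps(2)[OF F G t]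
      psh_cat_simps sheaf_cat_simps mem_Collect_eq nat_trans_psh_iff
    by (simp add: incl_def)
  fix H s assume H: "H \<in> Ob (sheaf_cat U A K)" and s: "s \<in> Hom (sheaf_cat U A K) G H"
  have "Comp (sheaf_cat U A K) F G H s t \<in> Hom (sheaf_cat U A K) F H"
    using cat_comp[OF category_sheaf_cat F G H t s] .
  then show "FAr (restr U) F H (Comp (sheaf_cat U A K) F G H s t) =
      Comp (psh_cat U A r) (FOb (restr U) F) (FOb (restr U) G) (FOb (restr U) H)
        (FAr (restr U) G H s) (FAr (restr U) F G t)"
    using F G H s t dn_in_K
    by (auto simp: restr_simps sheaf_cat_simps(4) psh_cat_simps(4) cong: restrict_cong)
qed (auto simp: restr_def)

text \<open>Both halves rest on the sheaf condition for the target \<open>G\<close>. By naturality,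
  the components at the \<open>dn z\<close> fix the restrictions of \<open>t B b\<close> to all
  \<open>dn z\<close> with \<open>z \<in> B\<close>. Separation then gives injectivity, and
  amalgamation gives surjectivity.\<close>

lemma restr_fully_faithful:
  assumes F: "F \<in> Ob (sheaf_cat U A K)" and G: "G \<in> Ob (sheaf_cat U A K)"
  shows "bij_betw (FAr (restr U) F G) (Hom (sheaf_cat U A K) F G)
    (Hom (psh_cat U A r) (FOb (restr U) F) (FOb (restr U) G))"
proof -
  let ?H = "Hom (sheaf_cat U A K) F G"
    and ?H' = "Hom (psh_cat U A r) (FOb (restr U) F) (FOb (restr U) G)"
  have Ff: "is_functor (op_cat (poset_cat K (incl K))) (set_cat U) F"
    and Gf: "is_functor (op_cat (poset_cat K (incl K))) (set_cat U) G"
    and Gsh: "is_sheaf K (covering_sieves A K) G"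
    using F G by (simp_all add: sheaf_cat_simps)
  have mem: "z \<in> A" if "B \<in> K" "z \<in> B" for B z using subset_if_in_K that by blast
  have "inj_on (FAr (restr U) F G) ?H"
  proof (rule inj_onI)
    fix s t assume s: "s \<in> ?H" and t: "t \<in> ?H" and eq: "FAr (restr U) F G s = FAr (restr U) F G t"
    have "(\<lambda>z\<in>A. s (dn z)) = (\<lambda>z\<in>A. t (dn z))"
      using eq by (simp add: restr_simps F G s t)
    then have dn: "s (dn z) = t (dn z)" if "z \<in> A" for z
      using that by (metis restrict_apply')
    have s': "s \<in> extensional K" "\<And>B. B \<in> K \<Longrightarrow> s B \<in> FOb F B \<rightarrow>\<^sub>E FOb G B"
      "\<And>B C a. B \<in> K \<Longrightarrow> C \<in> K \<Longrightarrow> C \<subseteq> B \<Longrightarrow> a \<in> FOb F B \<Longrightarrow> s C (FAr F B C () a) = FAr G B C () (s B a)"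
      and t': "t \<in> extensional K" "\<And>B. B \<in> K \<Longrightarrow> t B \<in> FOb F B \<rightarrow>\<^sub>E FOb G B"
      "\<And>B C a. B \<in> K \<Longrightarrow> C \<in> K \<Longrightarrow> C \<subseteq> B \<Longrightarrow> a \<in> FOb F B \<Longrightarrow> t C (FAr F B C () a) = FAr G B C () (t B a)"
      using s t by (simp_all add: sheaf_cat_simps nat_trans_incl_iff)
    show "s = t"
    proof (rule extensionalityI[OF s'(1) t'(1)])
      fix B assume B: "B \<in> K"
      show "s B = t B"
      proof (rule PiE_ext[OF s'(2)[OF B] t'(2)[OF B]])
        fix b assume b: "b \<in> FOb F B"
        show "s B b = t B b"
        proof (rule sheaf_separated[OF Gf Gsh B])
          show "s B b \<in> FOb G B" "t B b \<in> FOb G B"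
            using s'(2)[OF B] t'(2)[OF B] b by (simp_all add: PiE_iff)
          fix z assume z: "z \<in> B"
          note zB = dn_in_K[OF mem[OF B z]] dn_subset[OF B z]
          show "FAr G B (dn z) () (s B b) = FAr G B (dn z) () (t B b)"
            using s'(3)[OF B zB b] t'(3)[OF B zB b] dn[OF mem[OF B z]] by simp
        qed
      qed
    qed
  qed
  moreover have "FAr (restr U) F G ` ?H = ?H'"
  proof (rule antisym)
    show "FAr (restr U) F G ` ?H \<subseteq> ?H'"
      using functor_ar[OF is_functor_restr F G] by blast
    show "?H' \<subseteq> FAr (restr U) F G ` ?H"
    proof
      fix s assume "s \<in> ?H'"
      then have s: "s \<in> extensional A" "\<And>z. z \<in> A \<Longrightarrow> s z \<in> FOb F (dn z) \<rightarrow>\<^sub>E FOb G (dn z)"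
        "\<And>x y a. (y, x) \<in> r \<Longrightarrow> a \<in> FOb F (dn x) \<Longrightarrow>
          s y (FAr F (dn x) (dn y) () a) = FAr G (dn x) (dn y) () (s x a)"
        using r_in by (simp_all add: restr_simps F G psh_cat_simps nat_trans_psh_iff)
      have sin: "s z (FAr F B (dn z) () b) \<in> FOb G (dn z)"
        if B: "B \<in> K" and z: "z \<in> B" and b: "b \<in> FOb F B" for B z b
        using s(2)[OF mem[OF B z]] psh_incl_in[OF Ff B dn_in_K[OF mem[OF B z]] dn_subset[OF B z] b]
        by (simp add: PiE_iff)
      \<comment> \<open>The extension of \<open>s\<close> at \<open>B\<close> sends \<open>b\<close>
        to the amalgamation of the elements obtained by restricting \<open>b\<close> to
        \<open>dn z\<close> and applying \<open>s z\<close>; they are compatible by naturality of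
        \<open>s\<close>.\<close>
      have "\<exists>c\<in>FOb G B. \<forall>z\<in>B. FAr G B (dn z) () c = s z (FAr F B (dn z) () b)"
        if B: "B \<in> K" and b: "b \<in> FOb F B" for B b
      proof (rule sheaf_amalgamation[OF Gf Gsh B sin[OF B _ b]])
        fix z w assume z: "z \<in> B" and wz: "(w, z) \<in> r"
        note zB = dn_in_K[OF mem[OF B z]] dn_subset[OF B z]
        show "FAr G (dn z) (dn w) () (s z (FAr F B (dn z) () b)) = s w (FAr F B (dn w) () b)"
          using s(3)[OF wz psh_incl_in[OF Ff B zB b]]
            psh_incl_comp[OF Ff B zB(1) dn_in_K[OF r_in(1)[OF wz]] zB(2) dn_mono[OF wz] b] by simp
      qed
      then obtain t where t: "\<And>B b. B \<in> K \<Longrightarrow> b \<in> FOb F B \<Longrightarrow> t B b \<in> FOb G B"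
        "\<And>B b z. B \<in> K \<Longrightarrow> b \<in> FOb F B \<Longrightarrow> z \<in> B \<Longrightarrow>
          FAr G B (dn z) () (t B b) = s z (FAr F B (dn z) () b)"
        by metis
      let ?t = "\<lambda>B\<in>K. \<lambda>b\<in>FOb F B. t B b"
      have "t C (FAr F B C () b) = FAr G B C () (t B b)"
        if B: "B \<in> K" and C: "C \<in> K" "C \<subseteq> B" and b: "b \<in> FOb F B" for B C b
      proof (rule sheaf_separated[OF Gf Gsh C(1)])
        have bC: "FAr F B C () b \<in> FOb F C" by (rule psh_incl_in[OF Ff B C b])
        show "t C (FAr F B C () b) \<in> FOb G C" by (rule t(1)[OF C(1) bC])
        show "FAr G B C () (t B b) \<in> FOb G C" by (rule psh_incl_in[OF Gf B C t(1)[OF B b]])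
        fix z assume z: "z \<in> C"
        then have zB: "z \<in> B" using C(2) by blast
        note zC = dn_in_K[OF mem[OF C(1) z]] dn_subset[OF C(1) z]
        show "FAr G C (dn z) () (t C (FAr F B C () b)) = FAr G C (dn z) () (FAr G B C () (t B b))"
          using t(2)[OF C(1) bC z] psh_incl_comp[OF Ff B C(1) zC(1) C(2) zC(2) b] t(2)[OF B b zB]
            psh_incl_comp[OF Gf B C(1) zC(1) C(2) zC(2) t(1)[OF B b]] by simp
      qed
      then have tH: "?t \<in> ?H"
        using t(1) psh_incl_in[OF Ff] by (simp add: sheaf_cat_simps nat_trans_incl_iff)
      have "FAr (restr U) F G ?t = s"
      proof (rule extensionalityI[OF _ s(1)])
        show "FAr (restr U) F G ?t \<in> extensional A" by (simp add: restr_simps F G tH)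
        fix z assume z: "z \<in> A"
        have "(\<lambda>b\<in>FOb F (dn z). t (dn z) b) = s z"
        proof (rule extensionalityI[of _ "FOb F (dn z)"])
          fix b assume b: "b \<in> FOb F (dn z)"
          \<comment> \<open>For \<open>B = dn z\<close> the point \<open>z\<close> itself lies in
            \<open>B\<close>, and restriction from \<open>B\<close> to \<open>dn z\<close> is the
            identity, so the extension gives back \<open>s z\<close>.\<close>
          have "t (dn z) b = s z b"
            using t(2)[OF dn_in_K[OF z] b in_dn_self[OF z]] psh_incl_id[OF Ff dn_in_K[OF z] b]
              psh_incl_id[OF Gf dn_in_K[OF z] t(1)[OF dn_in_K[OF z] b]] by simp
          then show "(\<lambda>b\<in>FOb F (dn z). t (dn z) b) b = s z b" using b by simp
        qed (use s(2)[OF z] in \<open>simp_all add: PiE_iff\<close>)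
        then show "FAr (restr U) F G ?t z = s z"
          using z dn_in_K by (simp add: restr_simps F G tH)
      qed
      then show "s \<in> FAr (restr U) F G ` ?H" using tH by blast
    qed
  qed
  ultimately show ?thesis unfolding bij_betw_def by blast
qed

section \<open>Extension of presheaves to sheaves by limits\<close>

definition sections :: "('a, 'u) psh \<Rightarrow> 'a set \<Rightarrow> ('a \<Rightarrow> 'u) set" where
  "sections F B = {s \<in> Pi\<^sub>E B (FOb F). \<forall>x\<in>B. \<forall>y\<in>B. (y, x) \<in> r \<longrightarrow> FAr F x y () (s x) = s y}"

lemma restrict_sections: "s \<in> sections F B \<Longrightarrow> C \<subseteq> B \<Longrightarrow> restrict s C \<in> sections F C"
  unfolding sections_def by auto

text \<open>The sheaf \<open>E\<close> takes \<open>B\<close> to a coded copy of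
  \<open>sections F B\<close>, the limit of \<open>F\<close> over \<open>B\<close>. Gluing works
  because a covering sieve contains every \<open>dn z\<close> with \<open>z \<in> B\<close>, and a
  family is given by its values at points. \<open>E\<close> restricts to a copy of \<open>F\<close>
  because \<open>z\<close> is a greatest element of \<open>dn z\<close>, so a compatible family on
  \<open>dn z\<close> is determined by its value at \<open>z\<close>.\<close>

lemma restr_essentially_surjective:
  fixes U :: "'u set set"
  assumes U: "set_universe U" and fin: "finite A" and F: "F \<in> Ob (psh_cat U A r)"
  shows "\<exists>E\<in>Ob (sheaf_cat U A K). \<exists>t. is_iso (psh_cat U A r) (FOb (restr U) E) F t"
proof -
  have Ff: "is_functor (op_cat (poset_cat A r)) (set_cat U) F"
    using F by (simp add: psh_cat_simps)
  note F_ob = psh_ob[OF Ff r_refl r_trans] and F_in = psh_in[OF Ff r_refl r_trans]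
    and F_id = psh_id[OF Ff r_refl r_trans] and F_comp = psh_comp[OF Ff r_refl r_trans]
  have "\<exists>e. inj_on e (sections F B) \<and> e ` sections F B \<in> U" if B: "B \<in> K" for B
  proof -
    have BA: "B \<subseteq> A" by (rule subset_if_in_K[OF B])
    obtain e where e: "inj_on e (Pi\<^sub>E B (FOb F))" "e ` Pi\<^sub>E B (FOb F) \<in> U"
      using finite_PiE_embeds[OF U finite_subset[OF BA fin], of "FOb F"] F_ob BA by blast
    have sub: "sections F B \<subseteq> Pi\<^sub>E B (FOb F)" unfolding sections_def by blast
    then have "e ` sections F B \<in> U"
      using U e(2) image_mono[OF sub] unfolding set_universe_def by metis
    then show ?thesis using inj_on_subset[OF e(1) sub] by blast
  qed
  then obtain e where inj: "\<And>B. B \<in> K \<Longrightarrow> inj_on (e B) (sections F B)"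
    and eU: "\<And>B. B \<in> K \<Longrightarrow> e B ` sections F B \<in> U"
    by metis
  define d where "d B = inv_into (sections F B) (e B)" for B
  have de: "d B (e B s) = s" if "B \<in> K" "s \<in> sections F B" for B s
    unfolding d_def using inv_into_f_f[OF inj] that by blast
  have d_in: "d B u \<in> sections F B" and ed: "e B (d B u) = u"
    if "u \<in> e B ` sections F B" for B u
    unfolding d_def using that by (simp_all add: inv_into_into f_inv_into_f)
  \<comment> \<open>\<open>E B\<close> is the limit of \<open>F\<close> over \<open>B\<close>, coded by \<open>e B\<close> (with inverse \<open>d B\<close>) as a set in \<open>U\<close>\<close>
  define E :: "('a set, 'u) psh" where "E =
    \<lparr>FOb = (\<lambda>B. if B \<in> K then e B ` sections F B else undefined),
     FAr = (\<lambda>B C f. if (C, B) \<in> incl K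
       then (\<lambda>u\<in>e B ` sections F B. e C (restrict (d B u) C)) else undefined)\<rparr>"
  have E_ob: "FOb E B = e B ` sections F B" if "B \<in> K" for B
    using that by (simp add: E_def)
  have E_ar: "FAr E B C f = (\<lambda>u\<in>e B ` sections F B. e C (restrict (d B u) C))"
    if "B \<in> K" "C \<in> K" "C \<subseteq> B" for B C f
    using that by (simp add: E_def incl_def)
  have d_ar: "d C (FAr E B C () u) = restrict (d B u) C"
    if "B \<in> K" "C \<in> K" "C \<subseteq> B" "u \<in> FOb E B" for B C u
    using that de[OF that(2) restrict_sections[OF d_in that(3)]] by (simp add: E_ob E_ar)
  have E_in: "FAr E B C () u \<in> FOb E C"
    if "B \<in> K" "C \<in> K" "C \<subseteq> B" "u \<in> FOb E B" for B C u
    using that restrict_sections[OF d_in that(3)] by (simp add: E_ob E_ar)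
  \<comment> \<open>Equalities in \<open>E\<close> are tested after decoding, where by
    \<open>d_ar\<close> the restriction maps of \<open>E\<close> become restriction of
    functions.\<close>
  have d_inj: "u = v" if "B \<in> K" "u \<in> FOb E B" "v \<in> FOb E B" "d B u = d B v" for B u v
    using that ed E_ob by metis
  have d_ext: "restrict (d B u) B = d B u" if "B \<in> K" "u \<in> FOb E B" for B u
  proof -
    have "d B u \<in> sections F B" using that d_in E_ob by simp
    then show ?thesis unfolding sections_def by auto
  qed
  have Ef: "is_functor (op_cat (poset_cat K (incl K))) (set_cat U) E"
    unfolding is_functor_psh_iff[OF refl_on_incl trans_incl]
  proof (intro conjI ballI allI impI)
    fix B assume B: "B \<in> K"
    show "FOb E B \<in> U" using B eU by (simp add: E_ob)
    show "FAr E B B () u = u" if "u \<in> FOb E B" for u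
      using B that by (intro d_inj[of B]) (simp_all add: d_ar d_ext E_in)
    fix C assume C: "C \<in> K" and "(C, B) \<in> incl K"
    then have CB: "C \<subseteq> B" by (simp add: incl_def)
    show "FAr E B C () \<in> FOb E B \<rightarrow>\<^sub>E FOb E C"
      using E_in[OF B C CB] by (simp add: PiE_iff E_ar[OF B C CB] E_ob[OF B])
    fix D u assume D: "D \<in> K" and "(D, C) \<in> incl K" and u: "u \<in> FOb E B"
    then have DC: "D \<subseteq> C" by (simp add: incl_def)
    have DB: "D \<subseteq> B" using CB DC by blast
    note Cu = E_in[OF B C CB u]
    show "FAr E C D () (FAr E B C () u) = FAr E B D () u"
    proof (rule d_inj[OF D E_in[OF C D DC Cu] E_in[OF B D DB u]])
      show "d D (FAr E C D () (FAr E B C () u)) = d D (FAr E B D () u)"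
        using DC by (simp add: d_ar[OF C D DC Cu] d_ar[OF B C CB u] d_ar[OF B D DB u] Int_absorb1)
    qed
  qed (auto simp: E_def incl_def)
  have "is_sheaf K (covering_sieves A K) E"
    unfolding is_sheaf_def
  proof (intro ballI allI impI)
    fix B \<sigma> m assume B: "B \<in> K" and \<sigma>: "\<sigma> \<in> covering_sieves A K B" and m: "matching_family E \<sigma> m"
    have sub: "C \<in> K" "C \<subseteq> B" if "C \<in> \<sigma>" for C
      using \<sigma> that unfolding covering_sieves_iff[OF B] sieve_def by blast+
    have dn\<sigma>: "dn z \<in> \<sigma>" if "z \<in> B" for z
      using \<sigma> that unfolding covering_sieves_iff[OF B] by blast
    have mem: "z \<in> A" if "z \<in> B" for z using subset_if_in_K[OF B] that by blast
    have m_in: "m C \<in> FOb E C" if "C \<in> \<sigma>" for C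
      using m that unfolding matching_family_def by simp
    have m_sec: "d C (m C) \<in> sections F C" if "C \<in> \<sigma>" for C
      using m_in[OF that] sub[OF that] d_in by (simp add: E_ob)
    \<comment> \<open>The glued family reads its value at \<open>z\<close> from the member of the
      matching family at \<open>dn z\<close>. By \<open>sz\<close>, every other member of the sieve
      containing \<open>z\<close> yields the same value.\<close>
    define s where "s = (\<lambda>z\<in>B. d (dn z) (m (dn z)) z)"
    have sz: "s z = d C (m C) z" if C: "C \<in> \<sigma>" and z: "z \<in> C" for C z
    proof -
      have zB: "z \<in> B" using sub(2)[OF C] z by blast
      have dC: "dn z \<subseteq> C" by (rule dn_subset[OF sub(1)[OF C] z])
      have "FAr E C (dn z) () (m C) = m (dn z)"
        using m C dn\<sigma>[OF zB] dC unfolding matching_family_def by simp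
      then have "d (dn z) (m (dn z)) = restrict (d C (m C)) (dn z)"
        using d_ar[OF sub(1)[OF C] dn_in_K[OF mem[OF zB]] dC m_in[OF C]] by simp
      then show ?thesis using in_dn_self[OF mem[OF zB]] zB by (simp add: s_def)
    qed
    have s_sec: "s \<in> sections F B"
      unfolding sections_def
    proof (intro CollectI conjI ballI impI)
      show "s \<in> Pi\<^sub>E B (FOb F)"
      proof (rule PiE_I)
        fix z assume z: "z \<in> B"
        then show "s z \<in> FOb F z"
          using m_sec[OF dn\<sigma>[OF z]] in_dn_self[OF mem[OF z]] unfolding s_def sections_def by auto
      qed (simp add: s_def)
      fix x y assume x: "x \<in> B" and y: "y \<in> B" and yx: "(y, x) \<in> r"
      \<comment> \<open>Both points lie in \<open>dn x\<close>, so compatibility of \<open>s\<close>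
        between them is inherited from the single family at \<open>dn x\<close>.\<close>
      have xx: "x \<in> dn x" and yy: "y \<in> dn x"
        using in_dn_self[OF mem[OF x]] yx by (simp_all add: in_dn_iff)
      show "FAr F x y () (s x) = s y"
        using m_sec[OF dn\<sigma>[OF x]] xx yy yx
        unfolding sz[OF dn\<sigma>[OF x] xx] sz[OF dn\<sigma>[OF x] yy] sections_def by blast
    qed
    have dB: "d B (e B s) = s" by (rule de[OF B s_sec])
    have eB: "e B s \<in> FOb E B" using s_sec by (simp add: E_ob[OF B])
    show "\<exists>!a. a \<in> FOb E B \<and> (\<forall>C\<in>\<sigma>. FAr E B C () a = m C)"
    proof (rule ex1I[of _ "e B s"], intro conjI ballI eB)
      fix C assume C: "C \<in> \<sigma>"
      note CB = sub[OF C]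
      have "restrict s C = restrict (d C (m C)) C"
        using sz[OF C] by (auto simp: restrict_def)
      then have "d C (FAr E B C () (e B s)) = d C (m C)"
        unfolding d_ar[OF B CB eB] dB by (simp add: d_ext[OF CB(1) m_in[OF C]])
      then show "FAr E B C () (e B s) = m C"
        by (rule d_inj[OF CB(1) E_in[OF B CB eB] m_in[OF C]])
    next
      fix a assume a: "a \<in> FOb E B \<and> (\<forall>C\<in>\<sigma>. FAr E B C () a = m C)"
      have "d B a = s"
      proof (rule PiE_ext)
        show "d B a \<in> Pi\<^sub>E B (FOb F)"
          using d_in[of a B] a unfolding E_ob[OF B] sections_def by blast
        show "s \<in> Pi\<^sub>E B (FOb F)" using s_sec unfolding sections_def by blast
        fix z assume z: "z \<in> B"
        have "restrict (d B a) (dn z) = d (dn z) (m (dn z))"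
          using d_ar[OF B dn_in_K[OF mem[OF z]] dn_subset[OF B z], of a] a dn\<sigma>[OF z] by simp
        then show "d B a z = s z"
          using z in_dn_self[OF mem[OF z]] unfolding s_def by (metis restrict_apply')
      qed
      then show "a = e B s" using d_inj[OF B _ eB, of a] a dB by simp
    qed
  qed
  with Ef have E: "E \<in> Ob (sheaf_cat U A K)" by (simp add: sheaf_cat_simps)
  \<comment> \<open>The comparison with \<open>F\<close> evaluates the decoded family on
    \<open>dn z\<close> at the greatest element \<open>z\<close>.\<close>
  define t where "t = (\<lambda>z\<in>A. \<lambda>u\<in>FOb E (dn z). d (dn z) u z)"
  have t_bij: "bij_betw (t z) (FOb E (dn z)) (FOb F z)" if z: "z \<in> A" for z
  proof (rule bij_betw_imageI)
    note zK = dn_in_K[OF z] and zz = in_dn_self[OF z]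
    have dz: "d (dn z) u \<in> sections F (dn z)" if "u \<in> FOb E (dn z)" for u
      using that d_in by (simp add: E_ob zK)
    \<comment> \<open>A compatible family on \<open>dn z\<close> consists of the restrictions of its
      value at \<open>z\<close>. This gives injectivity of \<open>t z\<close>; the same formula
      applied to any \<open>a \<in> FOb F z\<close> gives the preimage for surjectivity.\<close>
    have det: "d (dn z) u = (\<lambda>x\<in>dn z. FAr F z x () (t z u))" if u: "u \<in> FOb E (dn z)" for u
    proof (rule PiE_ext[of _ "dn z" "FOb F"])
      show "d (dn z) u \<in> Pi\<^sub>E (dn z) (FOb F)" using dz[OF u] unfolding sections_def by blast
      have eq: "FAr F z x () (t z u) = d (dn z) u x" if "x \<in> dn z" for x
      proof -
        have "(x, z) \<in> r" using that by (simp add: in_dn_iff)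
        then show ?thesis
          using dz[OF u] that zz z u unfolding sections_def t_def by simp
      qed
      then show "(\<lambda>x\<in>dn z. FAr F z x () (t z u)) \<in> Pi\<^sub>E (dn z) (FOb F)"
        using dz[OF u] unfolding sections_def by auto
      show "d (dn z) u x = (\<lambda>x\<in>dn z. FAr F z x () (t z u)) x" if "x \<in> dn z" for x
        using eq that by simp
    qed
    show "inj_on (t z) (FOb E (dn z))"
    proof (rule inj_onI)
      fix u v assume u: "u \<in> FOb E (dn z)" and v: "v \<in> FOb E (dn z)" and "t z u = t z v"
      then have "d (dn z) u = d (dn z) v" using det[OF u] det[OF v] by simp
      then show "u = v" by (rule d_inj[OF zK u v])
    qed
    show "t z ` FOb E (dn z) = FOb F z"
    proof (intro antisym image_subsetI subsetI)
      fix u assume u: "u \<in> FOb E (dn z)"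
      then show "t z u \<in> FOb F z" using dz[OF u] zz z unfolding t_def sections_def by auto
    next
      fix a assume a: "a \<in> FOb F z"
      define s where "s = (\<lambda>x\<in>dn z. FAr F z x () a)"
      have s: "s \<in> sections F (dn z)"
        unfolding sections_def
      proof (intro CollectI conjI ballI impI)
        show "s \<in> Pi\<^sub>E (dn z) (FOb F)"
          using F_in[OF z r_in(1) _ a] by (auto simp: s_def in_dn_iff)
        fix x y assume x: "x \<in> dn z" and y: "y \<in> dn z" and yx: "(y, x) \<in> r"
        have "(x, z) \<in> r" using x by (simp add: in_dn_iff)
        then show "FAr F x y () (s x) = s y"
          using F_comp[OF z r_in(2)[OF yx] r_in(1)[OF yx] _ yx a] x y by (simp add: s_def)
      qed
      have "t z (e (dn z) s) = a"
        using s z zz F_id[OF z a] by (simp add: t_def E_ob zK de s_def[symmetric]) (simp add: s_def)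
      moreover have "e (dn z) s \<in> FOb E (dn z)" using s by (simp add: E_ob zK)
      ultimately show "a \<in> t z ` FOb E (dn z)" by blast
    qed
  qed
  have "nat_trans (op_cat (poset_cat A r)) (set_cat U) (restr_ob E) F t"
    unfolding nat_trans_psh_iff
  proof (intro conjI ballI impI)
    show "t \<in> extensional A" by (simp add: t_def)
    fix x assume x: "x \<in> A"
    show "t x \<in> FOb (restr_ob E) x \<rightarrow>\<^sub>E FOb F x"
      using bij_betwE[OF t_bij[OF x]] x by (simp add: PiE_iff) (simp add: t_def)
    fix y u assume y: "y \<in> A" and yx: "(y, x) \<in> r" and u: "u \<in> FOb (restr_ob E) x"
    have u': "u \<in> FOb E (dn x)" using u x by simp
    note K = dn_in_K[OF x] dn_in_K[OF y] dn_mono[OF yx]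
    have "d (dn x) u \<in> sections F (dn x)" using d_in[of u "dn x"] u' K(1) by (simp add: E_ob)
    moreover have "x \<in> dn x" "y \<in> dn x" "y \<in> dn y"
      using in_dn_self x y yx by (simp_all add: in_dn_iff)
    ultimately show "t y (FAr (restr_ob E) x y () u) = FAr F x y () (t x u)"
      using x y yx E_in[OF K u'] d_ar[OF K u'] u' by (simp add: t_def sections_def)
  qed
  moreover have "is_iso (set_cat U) (FOb (restr_ob E) x) (FOb F x) (t x)" if "x \<in> A" for x
    using that t_bij[OF that] by (intro is_iso_set_cat) (simp_all add: t_def)
  ultimately have "nat_iso (op_cat (poset_cat A r)) (set_cat U) (restr_ob E) F t"
    unfolding nat_iso_def by (simp add: op_cat_def poset_cat_def)
  then have "is_iso (psh_cat U A r) (restr_ob E) F t"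
    unfolding psh_cat_def
    by (intro nat_iso_imp_is_iso_functor_cat category_set_cat is_functor_restr_ob[OF Ef] Ff)
  then show ?thesis using E restr_simps(1)[OF E] by metis
qed

end

theorem proposition9:
  fixes U :: "'u set set" and A :: "'a set" and r :: "'a rel"
  assumes "set_universe U"
    and "finite A" and "partial_order_on A r"
  shows "equivalent_categories (psh_cat U A r) (sheaf_cat U A (poset_connectivity A r))"
proof -
  interpret preordered_set A r
    using assms(3) by unfold_locales (simp add: partial_order_on_def)
  \<comment> \<open>The functor runs from sheaves to presheaves, and the lemma names its target
    category first, which is the order of the goal.\<close>
  show ?thesis
    by (rule equivalent_categories_if_fully_faithful[OF category_sheaf_cat
          category_psh_cat[OF r_refl r_trans] is_functor_restr restr_fully_faithful
          restr_essentially_surjective[OF assms(1,2)]])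
qed

end
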